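(* Let $G$ be a finite simple graph with vertex set $\{x_1,\ldots,x_n\}$, let $\mathbb{K}$ be a field and $R=\mathbb{K}[x_1,\ldots,x_n]$. For all integers $b\ge 0$ and $a\geq 1$ with $b\le\nu(G)$ and $a+b\le\operatorname{pd}(R/I(G))$, $$t_{a+b}(G)\le t_a(G)+t_b(G).$$
   Context: The edge ideal of $G$ is $I(G)=(x_ix_j : \{x_i,x_j\}\in E(G))\subset R$. For each $i$, $t_i(G)=\sup\{j : \beta_{i,j}^R(R/I(G))\ne 0\}$, where $\beta^R_{i,j}$ are the graded Betti numbers over the standard graded ring $R$; $\operatorname{pd}$ denotes projective dimension over $R$. A matching is a set of pairwise disjoint edges; an induced matching is a matching which is an induced subgraph of $G$ (i.e. the subgraph induced on its vertices has no other edges); $\nu(G)$ is the largest size of an induced matching in $G$. *)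

theory Defs
  imports
    Complex_Main
    "HOL-Library.Poly_Mapping"
    "HOL-Library.Extended_Nat"
    "HOL-Library.Extended_Real"
begin

section \<open>Polynomials\<close>

text \<open>
  The polynomial ring over \<open>'k\<close> whose variables are the elements of \<open>'v\<close>: a monomial is its
  exponent vector \<open>'v \<Rightarrow>\<^sub>0 nat\<close>, and the ring structure is the convolution product of
  \<^theory>\<open>HOL-Library.Poly_Mapping\<close>.
\<close>

type_synonym ('v, 'k) mpoly = "('v \<Rightarrow>\<^sub>0 nat) \<Rightarrow>\<^sub>0 'k"

definition Var :: "'v \<Rightarrow> ('v, 'k::comm_ring_1) mpoly" where
  "Var x = Poly_Mapping.single (Poly_Mapping.single x 1) 1"

definition mon_degree :: "('v \<Rightarrow>\<^sub>0 nat) \<Rightarrow> nat" where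
  "mon_degree m = (\<Sum>x\<in>Poly_Mapping.keys m. Poly_Mapping.lookup m x)"

text \<open>The degree is an integer; for a negative degree only the zero polynomial qualifies.\<close>

definition homogeneous :: "int \<Rightarrow> ('v, 'k::comm_ring_1) mpoly \<Rightarrow> bool" where
  "homogeneous s p \<longleftrightarrow> (\<forall>m\<in>Poly_Mapping.keys p. int (mon_degree m) = s)"

lemma module_mult: "module ((*) :: 'r::comm_ring_1 \<Rightarrow> 'r \<Rightarrow> 'r)"
  by unfold_locales (simp_all add: algebra_simps)

definition ideal_gen :: "'r::comm_ring_1 set \<Rightarrow> 'r set" where
  "ideal_gen S = module.span (*) S"

definition irrelevant_ideal :: "('v, 'k::comm_ring_1) mpoly set" where
  "irrelevant_ideal = ideal_gen (range Var)"


section \<open>Resolutions of a cyclic module\<close>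

text \<open>
  All modules occurring in a resolution are submodules of the free module \<open>nat \<Rightarrow>\<^sub>0 'r\<close> of
  countable rank over \<open>'r\<close>, with the following scalar multiplication.
\<close>

definition scale_vec :: "'r::comm_ring_1 \<Rightarrow> (nat \<Rightarrow>\<^sub>0 'r) \<Rightarrow> (nat \<Rightarrow>\<^sub>0 'r)" where
  "scale_vec c v = Poly_Mapping.map ((*) c) v"

lemma lookup_scale_vec [simp]:
  "Poly_Mapping.lookup (scale_vec c v) b = c * Poly_Mapping.lookup v b"
  by (simp add: scale_vec_def Poly_Mapping.map.rep_eq when_def)

lemma module_scale_vec: "module (scale_vec :: 'r::comm_ring_1 \<Rightarrow> _)"
  by unfold_locales (auto intro!: poly_mapping_eqI simp: lookup_add algebra_simps)

text \<open>
  \<open>\<cdots> \<rightarrow> P 1 \<rightarrow> P 0 \<rightarrow> R/I \<rightarrow> 0\<close> is exact, where \<open>d i\<close> is the differential from \<open>P (Suc i)\<close> to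
  \<open>P i\<close>. The augmentation \<open>P 0 \<rightarrow> R/I\<close> is given by a lift \<open>e\<close> to a map into \<open>R\<close>, which exists
  since \<open>P 0\<close> will be projective. Only the restrictions of \<open>e\<close> and \<open>d i\<close> to \<open>P 0\<close> and
  \<open>P (Suc i)\<close> matter: a linear map on a direct summand extends to the whole free module.
\<close>

definition exact_resolution ::
  "'r::comm_ring_1 set \<Rightarrow> (nat \<Rightarrow> (nat \<Rightarrow>\<^sub>0 'r) set) \<Rightarrow> ((nat \<Rightarrow>\<^sub>0 'r) \<Rightarrow> 'r)
    \<Rightarrow> (nat \<Rightarrow> (nat \<Rightarrow>\<^sub>0 'r) \<Rightarrow> (nat \<Rightarrow>\<^sub>0 'r)) \<Rightarrow> bool" where
  "exact_resolution I P e d \<longleftrightarrow>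
     (\<forall>i. module.subspace scale_vec (P i)) \<and>
     module_hom scale_vec (*) e \<and>
     (\<forall>i. module_hom scale_vec scale_vec (d i)) \<and>
     (\<forall>f. \<exists>v\<in>P 0. f - e v \<in> I) \<and>
     d 0 ` P 1 = {v \<in> P 0. e v \<in> I} \<and>
     (\<forall>i. d (Suc i) ` P (Suc (Suc i)) = {v \<in> P (Suc i). d i v = 0})"

definition projective_submodule :: "(nat \<Rightarrow>\<^sub>0 'r::comm_ring_1) set \<Rightarrow> bool" where
  "projective_submodule P \<longleftrightarrow>
     module.subspace scale_vec P \<and>
     (\<exists>Q. module.subspace scale_vec Q \<and> P \<inter> Q = {0} \<and> {p + q | p q. p \<in> P \<and> q \<in> Q} = UNIV)"

text \<open>
  The projective dimension of \<open>R/I\<close>: the least length of a projective resolution, and \<open>\<infinity>\<close> if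
  there is no finite one (\<open>Inf {} = \<infinity>\<close> in \<^typ>\<open>enat\<close>). The direct summands of \<open>nat \<Rightarrow>\<^sub>0 'r\<close> are,
  up to isomorphism, exactly the countably generated projective modules. Over a Noetherian ring,
  the case of interest, the least length is attained by finitely generated projective modules,
  so that nothing is lost by taking the modules from this universe.
\<close>

definition proj_dim_quotient :: "'r::comm_ring_1 set \<Rightarrow> enat" where
  "proj_dim_quotient I =
     Inf {enat n | n. \<exists>P e d. exact_resolution I P e d \<and> (\<forall>i. projective_submodule (P i)) \<and>
                              (\<forall>i>n. P i = {0})}"


section \<open>Graded Betti numbers\<close>

definition free_on :: "nat set \<Rightarrow> (nat \<Rightarrow>\<^sub>0 'r::comm_ring_1) set" where
  "free_on B = {v. Poly_Mapping.keys v \<subseteq> B}"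

abbreviation basis_vec :: "nat \<Rightarrow> (nat \<Rightarrow>\<^sub>0 'r::comm_ring_1)" where
  "basis_vec b \<equiv> Poly_Mapping.single b 1"

text \<open>
  A minimal graded free resolution of \<open>R/I\<close>. The module in homological degree \<open>i\<close> is the direct
  sum of the \<open>R(- deg i b)\<close> over \<open>b \<in> B i\<close>, that is, free with basis vectors of degrees
  \<open>deg i b\<close>. All maps preserve degrees, and minimality means that the differentials map into the
  irrelevant ideal times the next module.
\<close>

definition minimal_graded_free_resolution ::
  "('v, 'k::field) mpoly set \<Rightarrow> (nat \<Rightarrow> nat set) \<Rightarrow> (nat \<Rightarrow> nat \<Rightarrow> int)
    \<Rightarrow> ((nat \<Rightarrow>\<^sub>0 ('v, 'k) mpoly) \<Rightarrow> ('v, 'k) mpoly)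
    \<Rightarrow> (nat \<Rightarrow> (nat \<Rightarrow>\<^sub>0 ('v, 'k) mpoly) \<Rightarrow> (nat \<Rightarrow>\<^sub>0 ('v, 'k) mpoly)) \<Rightarrow> bool" where
  "minimal_graded_free_resolution I B deg e d \<longleftrightarrow>
     (\<forall>i. finite (B i)) \<and>
     exact_resolution I (\<lambda>i. free_on (B i)) e d \<and>
     (\<forall>b\<in>B 0. homogeneous (deg 0 b) (e (basis_vec b))) \<and>
     (\<forall>i. \<forall>b\<in>B (Suc i). \<forall>c\<in>B i.
        homogeneous (deg (Suc i) b - deg i c) (Poly_Mapping.lookup (d i (basis_vec b)) c)) \<and>
     (\<forall>i. \<forall>v\<in>free_on (B (Suc i)). \<forall>c\<in>B i. Poly_Mapping.lookup (d i v) c \<in> irrelevant_ideal)"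

text \<open>
  The number of basis elements of degree \<open>j\<close> in homological degree \<open>i\<close> of a minimal graded free
  resolution of \<open>R/I\<close>, for a homogeneous ideal \<open>I\<close>; such a resolution exists and is unique up to
  isomorphism.
\<close>

definition betti_quotient :: "('v, 'k::field) mpoly set \<Rightarrow> nat \<Rightarrow> int \<Rightarrow> nat" where
  "betti_quotient I i j =
     (let (B, deg) = (SOME (B, deg). \<exists>e d. minimal_graded_free_resolution I B deg e d)
      in card {b \<in> B i. deg i b = j})"


section \<open>Graphs\<close>

text \<open>
  A simple graph whose vertex set is the whole type \<open>'v\<close>, which is finite in the theorem, is
  given by its set of edges.
\<close>

definition simple_graph :: "'v set set \<Rightarrow> bool" where
  "simple_graph E \<longleftrightarrow> (\<forall>a\<in>E. card a = 2)"

definition matching :: "'v set set \<Rightarrow> 'v set set \<Rightarrow> bool" where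
  "matching E M \<longleftrightarrow> M \<subseteq> E \<and> pairwise disjnt M"

definition induced_matching :: "'v set set \<Rightarrow> 'v set set \<Rightarrow> bool" where
  "induced_matching E M \<longleftrightarrow> matching E M \<and> {a \<in> E. a \<subseteq> \<Union>M} = M"

definition induced_matching_number :: "'v::finite set set \<Rightarrow> nat" where
  "induced_matching_number E = Max {card M | M. induced_matching E M}"

definition edge_ideal :: "'v set set \<Rightarrow> ('v, 'k::field) mpoly set" where
  "edge_ideal E = ideal_gen {Var x * Var y | x y. {x, y} \<in> E}"

text \<open>
  \<open>max_shift TYPE('k) E i\<close> is \<open>t\<^sub>i\<close> of the graph over the field \<open>'k\<close>; it is \<open>-\<infinity>\<close> if no Betti
  number in homological degree \<open>i\<close> is nonzero.
\<close>

definition max_shift :: "'k::field itself \<Rightarrow> 'v set set \<Rightarrow> nat \<Rightarrow> ereal" where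
  "max_shift K E i =
     Sup {ereal (real_of_int j) | j. betti_quotient (edge_ideal E :: ('v, 'k) mpoly set) i j \<noteq> 0}"

end

theory Submission
  imports Defs "HOL-Library.Countable"
begin

text \<open>
  By dimension shifting, a minimal graded free resolution of \<open>R/I\<close> has a basis element of
  degree \<open>j\<close> in homological degree \<open>i\<close> exactly when the \<open>i\<close>-th Koszul homology of \<open>R/I\<close> is
  nonzero in degree \<open>j\<close>. For an edge ideal this homology splits into multigraded strands. A
  strand that is not squarefree is contractible, and the strand of a vertex set \<open>W\<close> is the reduced cohomology of the
  independence complex on \<open>W\<close> (Hochster's formula). If \<open>{x, y}\<close> is an edge in \<open>W\<close>, the independence
  complex is the union of the deletions of \<open>x\<close> and of \<open>y\<close>, which meet in the complex on
  \<open>W - {x, y}\<close>; Mayer--Vietoris then gives \<open>t (i + 1) \<le> t i + 2\<close>. An induced matching with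
  \<open>b\<close> edges has a sphere as its independence complex, so \<open>t b \<ge> 2 * b\<close>. A minimal resolution with
  finite bases exists since the Koszul homology vanishes in degrees above the number of variables.
\<close>


section \<open>Signs\<close>

text \<open>The number 2 ties both halves together: \<open>b\<close> Mayer--Vietoris steps give
  \<open>t (a + b) \<le> t a + 2 * b\<close>, while \<open>b\<close> disjoint edges cover exactly
  \<open>2 * b\<close> vertices, so that \<open>2 * b \<le> t b\<close>. Only the vanishing of Betti
  numbers matters for this, so cohomology and Koszul homology appear as predicates and no dimension
  is ever computed.

  Two features of the definitions shape the rest. Betti numbers are read off a resolution picked by
  \<open>SOME\<close>, so every minimal resolution has to be compared with an object that is defined
  without one, and some minimal resolution has to be constructed. Exactness is stated without
  gradings, whereas the comparison takes place degree by degree, so homogeneous components of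
  preimages must be taken throughout.

  Quotients are never formed. A module \<open>M / N\<close> is a pair of graded families, and cycle
  and boundary equations hold modulo \<open>N\<close>. This treats the augmentation, where
  \<open>N\<close> comes from the ideal, and the differentials, where \<open>N\<close> is zero, as
  one case.\<close>

definition sg :: "'v::finite \<Rightarrow> 'v set \<Rightarrow> 'r::comm_ring_1" where
  "sg v T = (-1) ^ card {u \<in> T. to_nat u < to_nat v}"

lemma sg_square: "sg v T * sg v T = (1 :: 'r::comm_ring_1)"
  by (simp add: sg_def flip: power_add mult_2)

lemma sg_empty [simp]: "sg v {} = 1"
  by (simp add: sg_def)

lemma sg_insert_same [simp]: "sg v (insert v T) = sg v T"
  unfolding sg_def by (rule arg_cong[where f = "\<lambda>A. (-1) ^ card A"]) auto

lemma sg_remove_same [simp]: "sg v (T - {v}) = sg v T"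
  unfolding sg_def by (rule arg_cong[where f = "\<lambda>A. (-1) ^ card A"]) auto

lemma sg_insert:
  assumes "u \<notin> T" "u \<noteq> v"
  shows "sg v (insert u T) = (if to_nat u < to_nat v then - sg v T else (sg v T :: 'r::comm_ring_1))"
proof (cases "to_nat u < to_nat v")
  case True
  have "{w \<in> insert u T. to_nat w < to_nat v} = insert u {w \<in> T. to_nat w < to_nat v}"
    using True by auto
  then show ?thesis
    using True assms by (simp add: sg_def)
next
  case False
  have "{w \<in> insert u T. to_nat w < to_nat v} = {w \<in> T. to_nat w < to_nat v}"
    using False by auto
  then show ?thesis
    using False by (simp add: sg_def)
qed

text \<open>\<open>sg v T\<close> is the sign of sorting \<open>v\<close> into the wedge product of
  \<open>T\<close>, ordered by \<open>to_nat\<close>. Of the two factors with \<open>insert\<close>,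
  exactly the one belonging to the larger element changes sign. This is the source of every "square
  of the differential is zero" below.\<close>

lemma sg_anticomm:
  assumes "u \<noteq> v" "u \<notin> T" "v \<notin> T"
  shows "sg u T * sg v (insert u T) = - (sg v T * sg u (insert v T) :: 'r::comm_ring_1)"
proof -
  have "to_nat u \<noteq> to_nat v"
    using assms(1) by simp
  then show ?thesis
    using assms by (auto simp: sg_insert)
qed

lemma sg_anticomm_remove:
  assumes "u \<noteq> v" "u \<in> T" "v \<in> T"
  shows "sg u T * sg v (T - {u}) = - (sg v T * sg u (T - {v}) :: 'r::comm_ring_1)"
proof -
  define S where "S = T - {u} - {v}"
  have T: "T = insert u (insert v S)" "T - {u} = insert v S" "T - {v} = insert u S"
    "u \<notin> S" "v \<notin> S"
    using assms by (auto simp: S_def)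
  have "sg u T = (sg u (insert v S) :: 'r)" "sg v T = (sg v (insert u S) :: 'r)"
    using T(2,3) by (metis sg_remove_same)+
  then show ?thesis
    using sg_anticomm[OF assms(1) T(4,5), where 'r = 'r]
    unfolding T(2,3) by (simp add: mult.commute)
qed

text \<open>The variant for homotopies, where coning adds \<open>x\<close> while the coboundary
  removes \<open>v\<close>.\<close>

lemma sg_anticomm_mixed:
  assumes "v \<in> T" "x \<notin> T"
  shows "sg x T * sg v (insert x T) = - (sg v T * sg x (T - {v}) :: 'r::comm_ring_1)"
proof -
  define S where "S = T - {v}"
  have T: "T = insert v S" "v \<notin> S" "x \<notin> S" "x \<noteq> v"
    using assms by (auto simp: S_def)
  have "to_nat x \<noteq> to_nat v"
    using T by simp
  then show ?thesis
    unfolding S_def[symmetric] unfolding T(1) using T by (auto simp: sg_insert insert_commute[of x v])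
qed

text \<open>The terms are cancelled in pairs by induction. Showing that the sum equals its own
  negative would not suffice in characteristic 2.\<close>

lemma sum_antisymmetric:
  fixes f :: "'a \<Rightarrow> 'a \<Rightarrow> 'b::ab_group_add"
  assumes "finite A" and "\<And>u v. u \<in> A \<Longrightarrow> v \<in> A \<Longrightarrow> u \<noteq> v \<Longrightarrow> f u v = - f v u"
  shows "(\<Sum>u\<in>A. \<Sum>v\<in>A - {u}. f u v) = 0"
  using assms
proof (induction A rule: finite_induct)
  case empty
  then show ?case by simp
next
  case (insert a A)
  have "(\<Sum>v\<in>insert a A - {u}. f u v) = f u a + (\<Sum>v\<in>A - {u}. f u v)" if "u \<in> A" for u
  proof -
    have "insert a A - {u} = insert a (A - {u})"
      using insert.hyps that by auto
    then show ?thesis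
      using insert.hyps by simp
  qed
  moreover have "insert a A - {a} = A"
    using insert.hyps by auto
  ultimately have "(\<Sum>u\<in>insert a A. \<Sum>v\<in>insert a A - {u}. f u v)
      = (\<Sum>v\<in>A. f a v) + (\<Sum>u\<in>A. f u a) + (\<Sum>u\<in>A. \<Sum>v\<in>A - {u}. f u v)"
    using insert.hyps by (simp add: sum.distrib add.assoc)
  also have "(\<Sum>u\<in>A. \<Sum>v\<in>A - {u}. f u v) = 0"
    by (rule insert.IH) (rule insert.prems; simp)
  also have "(\<Sum>v\<in>A. f a v) = - (\<Sum>u\<in>A. f u a)"
    unfolding sum_negf[symmetric]
  proof (rule sum.cong[OF refl])
    fix v assume "v \<in> A"
    then show "f a v = - f v a"
      using insert.hyps by (intro insert.prems) auto
  qed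
  finally show ?case
    by simp
qed


section \<open>Cohomology of independence complexes\<close>

definition indep :: "'v set set \<Rightarrow> 'v set \<Rightarrow> bool" where
  "indep E T \<longleftrightarrow> (\<forall>e\<in>E. \<not> e \<subseteq> T)"

lemma indep_subset: "indep E T \<Longrightarrow> S \<subseteq> T \<Longrightarrow> indep E S"
  unfolding indep_def by blast

definition cobd :: "('v::finite set \<Rightarrow> 'k::comm_ring_1) \<Rightarrow> 'v set \<Rightarrow> 'k" where
  "cobd h T = (\<Sum>v\<in>T. sg v T * h (T - {v}))"

lemma cobd_empty [simp]: "cobd h {} = 0"
  by (simp add: cobd_def)

lemma cobd_cobd: "cobd (cobd h) T = (0 :: 'k::comm_ring_1)"
proof -
  have "cobd (cobd h) T = (\<Sum>u\<in>T. \<Sum>v\<in>T - {u}. sg u T * sg v (T - {u}) * h (T - {u} - {v}))"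
    by (simp add: cobd_def sum_distrib_left mult.assoc)
  also have "\<dots> = 0"
  proof (rule sum_antisymmetric)
    fix u v assume "u \<in> T" "v \<in> T" "u \<noteq> v"
    moreover have "T - {u} - {v} = T - {v} - {u}"
      by auto
    ultimately show "sg u T * sg v (T - {u}) * h (T - {u} - {v}) = - (sg v T * sg u (T - {v}) * h (T - {v} - {u}))"
      using sg_anticomm_remove[of u v T, where 'r = 'k] by simp
  qed simp
  finally show ?thesis .
qed

lemma cobd_diff: "cobd (\<lambda>T. g T - h T) T = cobd g T - cobd h T"
  by (simp add: cobd_def sum_subtractf algebra_simps)

lemma cobd_cong: "(\<And>v. v \<in> T \<Longrightarrow> g (T - {v}) = h (T - {v})) \<Longrightarrow> cobd g T = cobd h T"
  unfolding cobd_def by (auto intro: sum.cong)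

text \<open>
  Cochains are indexed by the cardinality of a face rather than its dimension: the reduced
  cohomology of the independence complex of \<open>E\<close> on \<open>W\<close> is nonzero in dimension \<open>q - 1\<close>. The values
  of a cochain at other sets are irrelevant.
\<close>

definition coh :: "'k::field itself \<Rightarrow> 'v::finite set set \<Rightarrow> 'v set \<Rightarrow> nat \<Rightarrow> bool" where
  "coh K E W q \<longleftrightarrow> (\<exists>f :: 'v set \<Rightarrow> 'k.
     (\<forall>T\<subseteq>W. indep E T \<longrightarrow> card T = Suc q \<longrightarrow> cobd f T = 0) \<and>
     \<not> (\<exists>h. \<forall>T\<subseteq>W. indep E T \<longrightarrow> card T = q \<longrightarrow> f T = cobd h T))"

lemma not_cohD:
  assumes "\<not> coh (K :: 'k::field itself) E W q"
    and "\<And>T. T \<subseteq> W \<Longrightarrow> indep E T \<Longrightarrow> card T = Suc q \<Longrightarrow> cobd (f :: 'v::finite set \<Rightarrow> 'k) T = 0"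
  obtains h where "\<And>T. T \<subseteq> W \<Longrightarrow> indep E T \<Longrightarrow> card T = q \<Longrightarrow> f T = cobd h T"
  using assms unfolding coh_def by blast

text \<open>Mayer--Vietoris for the cover by the deletions of \<open>x\<close> and of \<open>y\<close>, which covers since no
  independent set contains both.\<close>

lemma coh_Mayer_Vietoris:
  fixes E :: "'v::finite set set"
  assumes "{x, y} \<in> E" "coh K E W q"
  shows "coh K E (W - {x}) q \<or> coh K E (W - {y}) q \<or> (\<exists>r. q = Suc r \<and> coh K E (W - {x, y}) r)"
proof (rule ccontr)
  assume contra: "\<not> ?thesis"
  from assms(2) obtain f :: "'v set \<Rightarrow> 'a"
    where f: "\<And>T. T \<subseteq> W \<Longrightarrow> indep E T \<Longrightarrow> card T = Suc q \<Longrightarrow> cobd f T = 0"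
      and nb: "\<nexists>h. \<forall>T\<subseteq>W. indep E T \<longrightarrow> card T = q \<longrightarrow> f T = cobd h T"
    unfolding coh_def by auto
  from contra have "\<not> coh K E (W - {x}) q" "\<not> coh K E (W - {y}) q"
    by auto
  moreover have "cobd f T = 0" if "T \<subseteq> W - A" "indep E T" "card T = Suc q" for T A
    using that by (intro f) auto
  ultimately obtain h1 h2
    where h1: "\<And>T. T \<subseteq> W - {x} \<Longrightarrow> indep E T \<Longrightarrow> card T = q \<Longrightarrow> f T = cobd h1 T"
      and h2: "\<And>T. T \<subseteq> W - {y} \<Longrightarrow> indep E T \<Longrightarrow> card T = q \<Longrightarrow> f T = cobd h2 T"
    by (elim not_cohD[where f = f]) auto
  \<comment> \<open>On the intersection both primitives have coboundary \<open>f\<close>, so their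
    difference is a cocycle there. Writing \<open>Suc (card T) = q\<close> makes the claim vacuous
    for \<open>q = 0\<close>, where no lower cochains exist.\<close>
  have "\<exists>k. \<forall>T\<subseteq>W - {x, y}. indep E T \<longrightarrow> Suc (card T) = q \<longrightarrow> h1 T - h2 T = cobd k T"
  proof (cases q)
    case 0
    then show ?thesis by simp
  next
    case (Suc r)
    have "cobd (\<lambda>T. h1 T - h2 T) T = 0" if "T \<subseteq> W - {x, y}" "indep E T" "card T = Suc r" for T
    proof -
      have "T \<subseteq> W - {x}" "T \<subseteq> W - {y}"
        using that(1) by auto
      then show ?thesis
        using h1[of T] h2[of T] that Suc by (simp add: cobd_diff)
    qed
    moreover have "\<not> coh K E (W - {x, y}) r"
      using contra Suc by auto
    ultimately obtain k where "\<And>T. T \<subseteq> W - {x, y} \<Longrightarrow> indep E T \<Longrightarrow> card T = r \<Longrightarrow> h1 T - h2 T = cobd k T"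
      by (elim not_cohD[where f = "\<lambda>T. h1 T - h2 T"]) blast+
    then show ?thesis
      using Suc by auto
  qed
  then obtain k where k: "\<And>T. T \<subseteq> W - {x, y} \<Longrightarrow> indep E T \<Longrightarrow> Suc (card T) = q \<Longrightarrow> h1 T - h2 T = cobd k T"
    by blast
  \<comment> \<open>Extension by zero from the intersection to all sets, so that
    \<open>cobd k'\<close> can correct \<open>h1\<close> on the whole deletion of
    \<open>x\<close>.\<close>
  define k' where "k' T = (if T \<subseteq> W - {x, y} then k T else 0)" for T
  \<comment> \<open>Gluing: a face \<open>T\<close> containing \<open>x\<close> has only one facet
    avoiding \<open>x\<close>, namely \<open>T - {x}\<close>. That facet lies in the intersection,
    where the corrected \<open>h1\<close> agrees with \<open>h2\<close>.\<close>
  define g where "g T = (if x \<in> T then h2 T else h1 T - cobd k' T)" for T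
  have "f T = cobd g T" if T: "T \<subseteq> W" "indep E T" "card T = q" for T
  proof (cases "x \<in> T")
    case False
    then have "cobd g T = cobd (\<lambda>T. h1 T - cobd k' T) T"
      by (intro cobd_cong) (auto simp: g_def)
    also have "\<dots> = cobd h1 T"
      by (simp add: cobd_diff cobd_cobd)
    also have "\<dots> = f T"
      using h1[OF _ T(2,3)] T(1) False by (simp add: subset_Diff_insert)
    finally show ?thesis by simp
  next
    case True
    have y: "y \<notin> T"
      using True T(2) assms(1) unfolding indep_def by auto
    have "cobd g T = cobd h2 T"
    proof (rule cobd_cong)
      fix v assume v: "v \<in> T"
      show "g (T - {v}) = h2 (T - {v})"
      proof (cases "v = x")
        case False
        then show ?thesis using True by (simp add: g_def)
      next
        case True
        have sub: "T - {v} \<subseteq> W - {x, y}"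
          using T y True by auto
        have "cobd k' (T - {v}) = cobd k (T - {v})"
          using sub by (intro cobd_cong) (auto simp: k'_def)
        moreover have "Suc (card (T - {v})) = q"
          using T(3) card_Suc_Diff1[OF _ v] by simp
        ultimately show ?thesis
          using k[OF sub indep_subset[OF T(2)]] True by (simp add: g_def algebra_simps)
      qed
    qed
    also have "\<dots> = f T"
      using h2[OF _ T(2,3)] T(1) y by (simp add: subset_Diff_insert)
    finally show ?thesis by simp
  qed
  then show False
    using nb by blast
qed

text \<open>Coning with a vertex \<open>x\<close> contracts a full simplex. For
  \<open>W = {}\<close> there is no such vertex, and the empty face alone carries cohomology at
  \<open>q = 0\<close>.\<close>

lemma not_coh_simplex:
  assumes "indep E W" "W \<noteq> {}"
  shows "\<not> coh (K :: 'k::field itself) (E :: 'v::finite set set) W q"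
proof
  assume "coh K E W q"
  then obtain f :: "'v set \<Rightarrow> 'k"
    where f: "\<And>T. T \<subseteq> W \<Longrightarrow> indep E T \<Longrightarrow> card T = Suc q \<Longrightarrow> cobd f T = 0"
      and nb: "\<nexists>h. \<forall>T\<subseteq>W. indep E T \<longrightarrow> card T = q \<longrightarrow> f T = cobd h T"
    unfolding coh_def by auto
  obtain x where x: "x \<in> W"
    using assms(2) by blast
  define h where "h T = (if x \<in> T then 0 else sg x T * f (insert x T))" for T
  have "f T = cobd h T" if T: "T \<subseteq> W" "card T = q" for T
  proof (cases "x \<in> T")
    case True
    have "cobd h T = sg x T * h (T - {x}) + (\<Sum>v\<in>T - {x}. sg v T * h (T - {v}))"
      unfolding cobd_def using True by (intro sum.remove) auto
    also have "(\<Sum>v\<in>T - {x}. sg v T * h (T - {v})) = 0"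
      using True by (intro sum.neutral) (auto simp: h_def)
    also have "sg x T * h (T - {x}) = f T"
      using True by (simp add: h_def insert_absorb mult.assoc[symmetric] sg_square)
    finally show ?thesis by simp
  next
    case False
    \<comment> \<open>The cocycle condition is used on the coned face \<open>insert x T\<close>; the
      factor \<open>sg x T\<close> normalises the coefficient of \<open>f T\<close> to 1.\<close>
    have "0 = sg x T * cobd f (insert x T)"
      using f[of "insert x T"] T x False indep_subset[OF assms(1)] by auto
    also have "cobd f (insert x T) = sg x T * f T + (\<Sum>v\<in>T. sg v (insert x T) * f (insert x (T - {v})))"
    proof -
      have "insert x T - {v} = insert x (T - {v})" if "v \<in> T" for v
        using that False by auto
      then show ?thesis
        unfolding cobd_def using False by (simp add: sum.insert)
    qed
    also have "sg x T * \<dots> = f T + (\<Sum>v\<in>T. sg x T * sg v (insert x T) * f (insert x (T - {v})))"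
      by (simp add: distrib_left mult.assoc[symmetric] sg_square sum_distrib_left)
    also have "(\<Sum>v\<in>T. sg x T * sg v (insert x T) * f (insert x (T - {v}))) = - cobd h T"
      unfolding cobd_def sum_negf[symmetric]
      using False by (intro sum.cong refl) (simp add: sg_anticomm_mixed h_def)
    finally show ?thesis by (simp add: algebra_simps)
  qed
  then show False
    using nb by blast
qed

text \<open>The last hypothesis says that no edge joins \<open>{x, y}\<close> to \<open>W\<close>.
  The complex is then the join of the one on \<open>W\<close> with two isolated points, that is, its
  suspension, and the cohomology moves up by one.\<close>

lemma coh_suspension:
  assumes "coh K (E :: 'v::finite set set) W q" "{x, y} \<in> E" "x \<notin> W" "y \<notin> W" "x \<noteq> y"
    and "\<And>e. e \<in> E \<Longrightarrow> e \<subseteq> insert x (insert y W) \<Longrightarrow> e = {x, y} \<or> e \<subseteq> W"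
  shows "coh (K :: 'k::field itself) E (insert x (insert y W)) (Suc q)"
proof -
  from assms(1) obtain f :: "'v set \<Rightarrow> 'k"
    where f: "\<And>T. T \<subseteq> W \<Longrightarrow> indep E T \<Longrightarrow> card T = Suc q \<Longrightarrow> cobd f T = 0"
      and nb: "\<nexists>h. \<forall>T\<subseteq>W. indep E T \<longrightarrow> card T = q \<longrightarrow> f T = cobd h T"
    unfolding coh_def by auto
  \<comment> \<open>The product of \<open>f\<close> with the cochain dual to the vertex
    \<open>x\<close>. It represents the suspended class and vanishes on faces avoiding
    \<open>x\<close>, in particular on those containing \<open>y\<close>.\<close>
  define F where "F T = (if x \<in> T then sg x T * f (T - {x}) else 0)" for T
  have cocycle: "cobd F T = 0"
    if T: "T \<subseteq> insert x (insert y W)" "indep E T" "card T = Suc (Suc q)" for T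
  proof (cases "x \<in> T")
    case False
    then show ?thesis
      by (simp add: cobd_def F_def)
  next
    case True
    then have "y \<notin> T"
      using T(2) assms(2) unfolding indep_def by auto
    then have sub: "T - {x} \<subseteq> W"
      using T(1) by auto
    have "cobd F T = (\<Sum>v\<in>T - {x}. sg v T * F (T - {v}))"
      unfolding cobd_def using True by (subst sum.remove[OF _ True]) (auto simp: F_def)
    also have "\<dots> = (\<Sum>v\<in>T - {x}. - sg x T * (sg v (T - {x}) * f (T - {x} - {v})))"
    proof (rule sum.cong[OF refl])
      fix v assume v: "v \<in> T - {x}"
      have "T - {v} - {x} = T - {x} - {v}"
        by auto
      then show "sg v T * F (T - {v}) = - sg x T * (sg v (T - {x}) * f (T - {x} - {v}))"
        using sg_anticomm_remove[of v x T, where 'r = 'k] v True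
        by (auto simp: F_def mult.assoc[symmetric])
    qed
    also have "\<dots> = - sg x T * cobd f (T - {x})"
      by (simp only: cobd_def sum_distrib_left)
    also have "cobd f (T - {x}) = 0"
      using f[OF sub] indep_subset[OF T(2)] T(3) True by auto
    finally show ?thesis by simp
  qed
  moreover have False
    if h: "\<And>T. T \<subseteq> insert x (insert y W) \<Longrightarrow> indep E T \<Longrightarrow> card T = Suc q \<Longrightarrow> F T = cobd h T" for h
  proof -
    \<comment> \<open>If \<open>F\<close> were the coboundary of \<open>h\<close>, evaluating this
      on \<open>insert x T\<close> and on \<open>insert y T\<close> would give two expressions for
      \<open>h T\<close>. Their difference exhibits \<open>f\<close> as the coboundary of
      \<open>cone y - cone x\<close>, a contradiction.\<close>
    define cone where "cone z U = sg z U * h (insert z U)" for z U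
    have ins: "sg z T * cobd h (insert z T) = h T - cobd (cone z) T" if "z \<notin> T" for z T
    proof -
      have "cobd h (insert z T) = sg z T * h T + (\<Sum>v\<in>T. sg v (insert z T) * h (insert z (T - {v})))"
      proof -
        have "insert z T - {v} = insert z (T - {v})" if "v \<in> T" for v
          using that \<open>z \<notin> T\<close> by auto
        then show ?thesis
          unfolding cobd_def using \<open>z \<notin> T\<close> by (simp add: sum.insert)
      qed
      then have "sg z T * cobd h (insert z T)
          = h T + (\<Sum>v\<in>T. sg z T * sg v (insert z T) * h (insert z (T - {v})))"
        by (simp add: distrib_left mult.assoc[symmetric] sg_square sum_distrib_left)
      also have "(\<Sum>v\<in>T. sg z T * sg v (insert z T) * h (insert z (T - {v}))) = - cobd (cone z) T"
        unfolding cobd_def sum_negf[symmetric]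
        using \<open>z \<notin> T\<close> by (intro sum.cong refl) (simp add: sg_anticomm_mixed cone_def)
      finally show ?thesis by simp
    qed
    have "f T = cobd (\<lambda>U. cone y U - cone x U) T" if T: "T \<subseteq> W" "indep E T" "card T = q" for T
    proof -
      have "indep E (insert z T)" if z: "z \<in> {x, y}" for z
        unfolding indep_def
      proof (intro ballI notI)
        fix e assume e: "e \<in> E" "e \<subseteq> insert z T"
        then have "e = {x, y} \<or> e \<subseteq> W"
          using assms(6)[OF e(1)] z T(1) by blast
        then show False
          using e z T(1,2) assms(3-5) unfolding indep_def by blast
      qed
      moreover have notin: "x \<notin> T" "y \<notin> T"
        using T(1) assms(3,4) by auto
      ultimately have "F (insert x T) = cobd h (insert x T)" "F (insert y T) = cobd h (insert y T)"
        using T by (auto intro!: h)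
      then have "sg x T * (sg x T * f T) = h T - cobd (cone x) T" "0 = h T - cobd (cone y) T"
        using ins[of x T] ins[of y T] notin assms(5) by (simp_all add: F_def)
      then show ?thesis
        by (simp add: cobd_diff mult.assoc[symmetric] sg_square)
    qed
    then show False
      using nb by blast
  qed
  ultimately show ?thesis
    unfolding coh_def by blast
qed

text \<open>The complex with only the empty face is the sphere of dimension -1, from which the
  suspensions start. The constant 1 is not a coboundary because every \<open>cobd h {}\<close> is an
  empty sum.\<close>

lemma coh_empty: "coh (K :: 'k::field itself) (E :: 'v::finite set set) {} 0"
  if "{} \<notin> E"
  unfolding coh_def indep_def using that by (intro exI[of _ "\<lambda>_. 1"]) auto

text \<open>Each edge of the matching suspends once. That the matching is induced is what rules out
  edges between the new edge and the earlier ones.\<close>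

lemma coh_induced_matching:
  fixes E :: "'v::finite set set"
  assumes "finite M" "simple_graph E" "induced_matching E M"
  shows "coh K E (\<Union>M) (card M) \<and> card (\<Union>M) = 2 * card M"
  using assms(1,3)
proof (induction M rule: finite_induct)
  case empty
  then show ?case
    using assms(2) by (auto intro!: coh_empty simp: simple_graph_def)
next
  case (insert e M)
  from insert.prems have M: "insert e M \<subseteq> E" "pairwise disjnt (insert e M)"
    and ind: "\<And>a. a \<in> E \<Longrightarrow> a \<subseteq> \<Union>(insert e M) \<Longrightarrow> a = e \<or> a \<in> M"
    unfolding induced_matching_def matching_def by blast+
  have disj: "e \<inter> \<Union>M = {}"
    using M(2) insert.hyps(2) unfolding pairwise_insert disjnt_def by blast
  have nonempty: "{} \<notin> E" and "card e = 2"
    using assms(2) M(1) unfolding simple_graph_def by auto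
  then obtain x y where e: "e = {x, y}" "x \<noteq> y"
    by (auto simp: card_2_iff)
  have xy: "x \<notin> \<Union>M" "y \<notin> \<Union>M"
    using disj e by auto
  have "induced_matching E M"
  proof -
    have "{a \<in> E. a \<subseteq> \<Union>M} = M"
    proof
      show "{a \<in> E. a \<subseteq> \<Union>M} \<subseteq> M"
      proof
        fix a assume "a \<in> {a \<in> E. a \<subseteq> \<Union>M}"
        then have "a \<in> E" "a \<subseteq> \<Union>M"
          by auto
        then show "a \<in> M"
          using ind[of a] disj e by auto
      qed
    qed (use M in auto)
    then show ?thesis
      using M unfolding induced_matching_def matching_def by (auto intro: pairwise_subset)
  qed
  note IH = insert.IH[OF this]
  have U: "\<Union>(insert e M) = insert x (insert y (\<Union>M))"
    using e by auto
  have "coh K E (insert x (insert y (\<Union>M))) (Suc (card M))"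
  proof (rule coh_suspension)
    fix a assume "a \<in> E" "a \<subseteq> insert x (insert y (\<Union>M))"
    then show "a = {x, y} \<or> a \<subseteq> \<Union>M"
      using ind[of a] U e by auto
  qed (use IH M e xy in auto)
  moreover have "card (insert x (insert y (\<Union>M))) = 2 * Suc (card M)"
    using IH xy e(2) by simp
  ultimately show ?case
    unfolding U using insert.hyps by simp
qed


section \<open>Koszul homology of a graded quotient\<close>

text \<open>The Koszul differential on coefficient functions: \<open>c S\<close> is the coefficient
  of the wedge product of \<open>S\<close>, and the coefficient at \<open>T\<close> collects the
  contributions of all sets with one element more.\<close>

definition bd :: "(('v::finite, 'k::field) mpoly \<Rightarrow> 'm::ab_group_add \<Rightarrow> 'm) \<Rightarrow> ('v set \<Rightarrow> 'm) \<Rightarrow> 'v set \<Rightarrow> 'm" where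
  "bd s c T = (\<Sum>v\<in>-T. s (sg v T * Var v) (c (insert v T)))"

text \<open>
  A graded module is given by the family of its homogeneous components inside an ungraded
  module.
\<close>

definition graded_family :: "(('v, 'k::field) mpoly \<Rightarrow> 'm::ab_group_add \<Rightarrow> 'm) \<Rightarrow> (int \<Rightarrow> 'm set) \<Rightarrow> bool" where
  "graded_family s M \<longleftrightarrow> (\<forall>j. 0 \<in> M j \<and> (\<forall>x\<in>M j. \<forall>y\<in>M j. x + y \<in> M j \<and> x - y \<in> M j) \<and>
     (\<forall>v. \<forall>x\<in>M j. s (Var v) x \<in> M (j + 1)))"

text \<open>Every wedge factor has degree 1, whence the shift \<open>j - int p\<close>. Chains
  vanish at sets of other cardinalities, so a chain of homological degree \<open>p\<close> is a
  function on all sets.\<close>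

definition kchains :: "(int \<Rightarrow> 'm set) \<Rightarrow> nat \<Rightarrow> int \<Rightarrow> ('v set \<Rightarrow> 'm::zero) set" where
  "kchains M p j = {c. \<forall>S. c S \<in> (if card S = p then M (j - int p) else {0})}"

text \<open>The degree \<open>j\<close> part of the \<open>p\<close>-th Koszul homology of \<open>M / N\<close> is nonzero.\<close>

definition tor :: "(('v::finite, 'k::field) mpoly \<Rightarrow> 'm::ab_group_add \<Rightarrow> 'm) \<Rightarrow> (int \<Rightarrow> 'm set) \<Rightarrow> (int \<Rightarrow> 'm set)
    \<Rightarrow> nat \<Rightarrow> int \<Rightarrow> bool" where
  "tor s M N p j \<longleftrightarrow> (\<exists>c\<in>kchains M p j. (\<forall>T. bd s c T \<in> N (j - int (card T))) \<and>
     \<not> (\<exists>h\<in>kchains M (Suc p) j. \<forall>S. c S - bd s h S \<in> N (j - int (card S))))"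

lemma graded_family_0: "graded_family s M \<Longrightarrow> 0 \<in> M j"
  and graded_family_add: "graded_family s M \<Longrightarrow> x \<in> M j \<Longrightarrow> y \<in> M j \<Longrightarrow> x + y \<in> M j"
  and graded_family_diff: "graded_family s M \<Longrightarrow> x \<in> M j \<Longrightarrow> y \<in> M j \<Longrightarrow> x - y \<in> M j"
  and graded_family_Var: "graded_family s M \<Longrightarrow> x \<in> M j \<Longrightarrow> s (Var v) x \<in> M (j + 1)"
  unfolding graded_family_def by blast+

lemma graded_family_sum:
  assumes "graded_family s M" "\<And>x. x \<in> A \<Longrightarrow> f x \<in> M j"
  shows "sum f A \<in> M j"
  using assms(2)
  by (induction A rule: infinite_finite_induct)
     (auto intro: graded_family_0[OF assms(1)] graded_family_add[OF assms(1)])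

lemma graded_family_zero: "module s \<Longrightarrow> graded_family s (\<lambda>_. {0})"
  by (simp add: graded_family_def module.scale_zero_right)

lemma sg_cases: "sg v T = (1 :: 'r::comm_ring_1) \<or> sg v T = (- 1 :: 'r)"
  unfolding sg_def by (cases "even (card {u \<in> T. to_nat u < to_nat v})") auto

lemma graded_family_sg_Var:
  assumes "module s" "graded_family s M" "x \<in> M j"
  shows "s (sg v T * Var v) x \<in> M (j + 1)"
proof -
  interpret module s by fact
  have "s (Var v) x \<in> M (j + 1)" "0 - s (Var v) x \<in> M (j + 1)"
    by (rule graded_family_Var[OF assms(2,3)],
        rule graded_family_diff[OF assms(2) graded_family_0[OF assms(2)] graded_family_Var[OF assms(2,3)]])
  then show ?thesis
    using sg_cases[of v T, where 'r = "('a, 'b) mpoly"] by auto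
qed

lemma bd_bd:
  assumes "module s"
  shows "bd s (bd s c) T = 0"
proof -
  interpret module s by fact
  let ?f = "\<lambda>u v. s (sg u T * Var u * (sg v (insert u T) * Var v)) (c (insert v (insert u T)))"
  have "bd s (bd s c) T = (\<Sum>u\<in>-T. \<Sum>v\<in>-T - {u}. ?f u v)"
    unfolding bd_def by (intro sum.cong refl) (auto simp: scale_sum_right intro: sum.cong)
  also have "\<dots> = 0"
  proof (rule sum_antisymmetric)
    fix u v assume uv: "u \<in> -T" "v \<in> -T" "u \<noteq> v"
    have "sg u T * Var u * (sg v (insert u T) * Var v)
        = (sg u T * sg v (insert u T)) * (Var u * Var v :: ('a, 'b) mpoly)"
      by (simp only: mult_ac)
    also have "\<dots> = - (sg v T * Var v * (sg u (insert v T) * Var u))"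
      using uv by (subst sg_anticomm) (auto simp: mult_ac)
    finally show "?f u v = - ?f v u"
      by (simp add: insert_commute)
  qed simp
  finally show ?thesis .
qed

lemma bd_diff:
  assumes "module s"
  shows "bd s (\<lambda>S. c S - c' S) T = bd s c T - bd s c' T"
proof -
  interpret module s by fact
  show ?thesis
    by (simp add: bd_def scale_right_diff_distrib sum_subtractf)
qed

lemma bd_hom:
  assumes "module_hom s1 s2 \<phi>"
  shows "bd s2 (\<lambda>S. \<phi> (c S)) T = \<phi> (bd s1 c T)"
proof -
  interpret module_hom s1 s2 \<phi> by fact
  show ?thesis
    by (simp add: bd_def sum scale)
qed

lemma bd_in_family:
  assumes "module s" "graded_family s N" "\<And>S. c S \<in> N (j - int (card S))"
  shows "bd s c T \<in> N (j - int (card T))"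
  unfolding bd_def
proof (rule graded_family_sum[OF assms(2)])
  fix v assume "v \<in> -T"
  then have "c (insert v T) \<in> N (j - int (card T) - 1)"
    using assms(3)[of "insert v T"] by (simp add: algebra_simps)
  from graded_family_sg_Var[OF assms(1,2) this] show "s (sg v T * Var v) (c (insert v T)) \<in> N (j - int (card T))"
    by simp
qed

lemma kchainsI: "(\<And>S. card S = p \<Longrightarrow> c S \<in> M (j - int p)) \<Longrightarrow> (\<And>S. card S \<noteq> p \<Longrightarrow> c S = 0) \<Longrightarrow> c \<in> kchains M p j"
  by (auto simp: kchains_def)

lemma kchainsD: "c \<in> kchains M p j \<Longrightarrow> card S = p \<Longrightarrow> c S \<in> M (j - int p)"
  and kchains_zero: "c \<in> kchains M p j \<Longrightarrow> card S \<noteq> p \<Longrightarrow> c S = 0"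
  by (auto simp: kchains_def dest: spec[where x = S])

lemma kchains_family:
  assumes "graded_family s M" "c \<in> kchains M p j"
  shows "c S \<in> M (j - int (card S))"
  using kchainsD[OF assms(2), of S] kchains_zero[OF assms(2), of S] graded_family_0[OF assms(1)] by metis

lemma kchains_mono:
  assumes "c \<in> kchains M p j" "\<And>i x. x \<in> M i \<Longrightarrow> x \<in> M' i"
  shows "c \<in> kchains M' p j"
  using kchainsD[OF assms(1)] kchains_zero[OF assms(1)] assms(2) by (blast intro: kchainsI)

lemma kchains_diff:
  assumes "graded_family s M" "c \<in> kchains M p j" "c' \<in> kchains M p j"
  shows "(\<lambda>S. c S - c' S) \<in> kchains M p j"
  by (rule kchainsI)
     (simp_all add: graded_family_diff[OF assms(1) kchainsD[OF assms(2)] kchainsD[OF assms(3)]]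
       kchains_zero[OF assms(2)] kchains_zero[OF assms(3)])

lemma kchains_bd:
  assumes "module s" "graded_family s M" "c \<in> kchains M (Suc p) j"
  shows "bd s c \<in> kchains M p j"
proof (rule kchainsI)
  fix S :: "'a set"
  {
    assume "card S = p"
    then show "bd s c S \<in> M (j - int p)"
      using bd_in_family[OF assms(1,2) kchains_family[OF assms(2,3)], of S] by simp
  next
    assume "card S \<noteq> p"
    then have "c (insert v S) = 0" if "v \<notin> S" for v
      using that by (intro kchains_zero[OF assms(3)]) simp
    then show "bd s c S = 0"
      using assms(1) by (auto simp: bd_def module.scale_zero_right intro: sum.neutral)
  }
qed

text \<open>A map \<open>\<phi>\<close> from \<open>F\<close> onto \<open>M / N\<close>, represented
  by a lift into the ambient module, with kernel \<open>Z\<close>. It covers both the augmentation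
  of a resolution and each of its differentials.\<close>

locale graded_presentation =
  fixes s1 :: "('v::finite, 'k::field) mpoly \<Rightarrow> 'f::ab_group_add \<Rightarrow> 'f"
    and s2 :: "('v, 'k) mpoly \<Rightarrow> 'm::ab_group_add \<Rightarrow> 'm"
    and \<phi> :: "'f \<Rightarrow> 'm" and F :: "int \<Rightarrow> 'f set" and M N :: "int \<Rightarrow> 'm set" and Z :: "int \<Rightarrow> 'f set"
  assumes hom: "module_hom s1 s2 \<phi>"
    and F: "graded_family s1 F" and N: "graded_family s2 N"
    and image: "\<And>j x. x \<in> F j \<Longrightarrow> \<phi> x \<in> M j"
    and surj: "\<And>j m. m \<in> M j \<Longrightarrow> \<exists>f\<in>F j. m - \<phi> f \<in> N j"
    and Z: "\<And>j. Z j = {f \<in> F j. \<phi> f \<in> N j}"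
begin

sublocale module_hom s1 s2 \<phi> by (rule hom)

lemma Z_family: "graded_family s1 Z"
  unfolding graded_family_def Z
  using F N by (auto simp: add diff scale intro: graded_family_0 graded_family_add graded_family_diff graded_family_Var)

lemma lift_chain:
  assumes "c \<in> kchains M p j"
  obtains c' where "c' \<in> kchains F p j" "\<And>S. c S - \<phi> (c' S) \<in> N (j - int (card S))"
proof -
  have "\<exists>f. \<forall>S. (card S = p \<longrightarrow> f S \<in> F (j - int p) \<and> c S - \<phi> (f S) \<in> N (j - int p))"
    using surj[OF kchainsD[OF assms]] by (intro choice) blast
  then obtain f where f: "\<And>S. card S = p \<Longrightarrow> f S \<in> F (j - int p)"
    "\<And>S. card S = p \<Longrightarrow> c S - \<phi> (f S) \<in> N (j - int p)"
    by blast
  show thesis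
  proof (rule that[of "\<lambda>S. if card S = p then f S else 0"])
    fix S
    show "c S - \<phi> (if card S = p then f S else 0) \<in> N (j - int (card S))"
      using f(2) kchains_zero[OF assms] graded_family_0[OF N] by auto
  next
    show "(\<lambda>S. if card S = p then f S else 0) \<in> kchains F p j"
      by (rule kchainsI) (simp_all add: f(1))
  qed
qed

lemma image_chain: "c \<in> kchains F p j \<Longrightarrow> (\<lambda>S. \<phi> (c S)) \<in> kchains M p j"
  by (rule kchainsI) (auto intro: image dest: kchainsD simp: kchains_zero)

lemma kernel_chain:
  assumes "c \<in> kchains F p j" "\<And>S. \<phi> (c S) \<in> N (j - int (card S))"
  shows "c \<in> kchains Z p j"
proof (rule kchainsI)
  fix S
  show "c S \<in> Z (j - int p)" if "card S = p"
    using kchainsD[OF assms(1) that] assms(2)[of S] that by (simp add: Z)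
  show "c S = 0" if "card S \<noteq> p"
    using kchains_zero[OF assms(1) that] .
qed

text \<open>The connecting isomorphism of the long exact sequence of \<open>0 \<rightarrow> Z \<rightarrow> F \<rightarrow> M/N \<rightarrow> 0\<close>. For
  \<open>p = 0\<close> the second hypothesis says that \<open>Z\<close> is contained in the irrelevant ideal times \<open>F\<close>.\<close>

lemma tor_syzygy:
  assumes acyclic: "\<And>c. c \<in> kchains F (Suc p) j \<Longrightarrow> \<forall>T. bd s1 c T = 0 \<Longrightarrow>
      \<exists>h\<in>kchains F (Suc (Suc p)) j. \<forall>T. bd s1 h T = c T"
    and bounds: "\<And>z. z \<in> kchains Z p j \<Longrightarrow> \<forall>T. bd s1 z T = 0 \<Longrightarrow> \<exists>c\<in>kchains F (Suc p) j. \<forall>T. bd s1 c T = z T"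
  shows "tor s2 M N (Suc p) j \<longleftrightarrow> tor s1 Z (\<lambda>_. {0}) p j"
proof
  assume "tor s2 M N (Suc p) j"
  then obtain c where c: "c \<in> kchains M (Suc p) j" "\<And>T. bd s2 c T \<in> N (j - int (card T))"
    and nb: "\<And>h. h \<in> kchains M (Suc (Suc p)) j \<Longrightarrow> \<not> (\<forall>S. c S - bd s2 h S \<in> N (j - int (card S)))"
    unfolding tor_def by blast
  obtain c' where c': "c' \<in> kchains F (Suc p) j" "\<And>S. c S - \<phi> (c' S) \<in> N (j - int (card S))"
    using lift_chain[OF c(1)] by blast
  \<comment> \<open>The connecting map: lift the cycle to \<open>F\<close> and take its boundary,
    which \<open>\<phi>\<close> sends into \<open>N\<close>.\<close>
  let ?z = "bd s1 c'"
  have z: "?z \<in> kchains F p j"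
    by (rule kchains_bd[OF m1.module_axioms F c'(1)])
  have "\<phi> (?z T) \<in> N (j - int (card T))" for T
  proof -
    have "bd s2 (\<lambda>S. c S - \<phi> (c' S)) T \<in> N (j - int (card T))"
      by (rule bd_in_family[OF m2.module_axioms N c'(2)])
    then have "bd s2 c T - \<phi> (?z T) \<in> N (j - int (card T))"
      by (simp add: bd_diff[OF m2.module_axioms] bd_hom[OF hom])
    from graded_family_diff[OF N c(2) this] show ?thesis
      by simp
  qed
  then have "?z \<in> kchains Z p j"
    by (rule kernel_chain[OF z])
  moreover have False if h: "h \<in> kchains Z (Suc p) j" "\<forall>S. ?z S - bd s1 h S \<in> {0}" for h
  proof -
    \<comment> \<open>If \<open>?z\<close> bounds within \<open>Z\<close>, the corrected lift is a
      cycle in \<open>F\<close> and hence a boundary. Since \<open>\<phi>\<close> maps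
      \<open>h\<close> into \<open>N\<close>, the original \<open>c\<close> bounds modulo
      \<open>N\<close>.\<close>
    have "(\<lambda>S. c' S - h S) \<in> kchains F (Suc p) j"
      using h(1) by (intro kchains_diff[OF F c'(1)] kchains_mono[OF h(1)]) (simp add: Z)
    moreover have "\<forall>T. bd s1 (\<lambda>S. c' S - h S) T = 0"
      using h(2) by (simp add: bd_diff[OF m1.module_axioms])
    ultimately obtain g where g: "g \<in> kchains F (Suc (Suc p)) j" "\<forall>T. bd s1 g T = c' T - h T"
      using acyclic by blast
    have "c S - bd s2 (\<lambda>S. \<phi> (g S)) S \<in> N (j - int (card S))" for S
    proof -
      have "h S \<in> Z (j - int (card S))"
        by (rule kchains_family[OF Z_family h(1)])
      then have "(c S - \<phi> (c' S)) + \<phi> (h S) \<in> N (j - int (card S))"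
        by (intro graded_family_add[OF N c'(2)]) (simp add: Z)
      then show ?thesis
        unfolding bd_hom[OF hom] g(2)[rule_format] by (simp add: diff algebra_simps)
    qed
    then show False
      using nb[OF image_chain[OF g(1)]] by blast
  qed
  ultimately show "tor s1 Z (\<lambda>_. {0}) p j"
    unfolding tor_def by (intro bexI[of _ ?z]) (auto simp: bd_bd[OF m1.module_axioms])
next
  assume "tor s1 Z (\<lambda>_. {0}) p j"
  then obtain z where z: "z \<in> kchains Z p j" "\<And>T. bd s1 z T = 0"
    and nb: "\<And>h. h \<in> kchains Z (Suc p) j \<Longrightarrow> \<not> (\<forall>S. z S - bd s1 h S = 0)"
    unfolding tor_def by auto
  obtain c' where c': "c' \<in> kchains F (Suc p) j" "\<And>T. bd s1 c' T = z T"
    using bounds z by blast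
  let ?c = "\<lambda>S. \<phi> (c' S)"
  have "bd s2 ?c T \<in> N (j - int (card T))" for T
    using kchains_family[OF Z_family z(1), of T] by (simp add: bd_hom[OF hom] c'(2) Z)
  moreover have False
    if h: "h \<in> kchains M (Suc (Suc p)) j" "\<forall>S. ?c S - bd s2 h S \<in> N (j - int (card S))" for h
  proof -
    obtain h' where h': "h' \<in> kchains F (Suc (Suc p)) j" "\<And>S. h S - \<phi> (h' S) \<in> N (j - int (card S))"
      using lift_chain[OF h(1)] by blast
    \<comment> \<open>Subtracting a boundary moves \<open>c'\<close> into \<open>Z\<close> without
      changing its own boundary \<open>z\<close>, so \<open>z\<close> would bound within
      \<open>Z\<close>.\<close>
    let ?g = "\<lambda>S. c' S - bd s1 h' S"
    have g: "?g \<in> kchains F (Suc p) j"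
      by (intro kchains_diff[OF F c'(1)] kchains_bd[OF m1.module_axioms F h'(1)])
    have "\<phi> (?g S) \<in> N (j - int (card S))" for S
    proof -
      have "bd s2 (\<lambda>S. h S - \<phi> (h' S)) S \<in> N (j - int (card S))"
        by (rule bd_in_family[OF m2.module_axioms N h'(2)])
      then have "bd s2 h S - \<phi> (bd s1 h' S) \<in> N (j - int (card S))"
        by (simp add: bd_diff[OF m2.module_axioms] bd_hom[OF hom])
      from graded_family_add[OF N spec[OF h(2)] this] show ?thesis
        by (simp add: diff)
    qed
    then have "?g \<in> kchains Z (Suc p) j"
      by (rule kernel_chain[OF g])
    moreover have "z S - bd s1 ?g S = 0" for S
      by (simp add: bd_diff[OF m1.module_axioms] bd_bd[OF m1.module_axioms] c'(2))
    ultimately show False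
      using nb by blast
  qed
  ultimately show "tor s2 M N (Suc p) j"
    unfolding tor_def using image_chain[OF c'(1)] by blast
qed

end


section \<open>Homogeneous polynomials and monomial ideals\<close>

abbreviation lookup where "lookup \<equiv> Poly_Mapping.lookup"
abbreviation keys where "keys \<equiv> Poly_Mapping.keys"
abbreviation single where "single \<equiv> Poly_Mapping.single"

lemma poly_mapping_sum_single: "p = (\<Sum>m\<in>keys p. single m (lookup p m))"
proof (rule poly_mapping_eqI)
  fix k
  show "lookup p k = lookup (\<Sum>m\<in>keys p. single m (lookup p m)) k"
    by (cases "k \<in> keys p") (auto simp: lookup_sum lookup_single when_def in_keys_iff sum.delta')
qed

lemma lookup_Var_mult:
  "lookup (Var v * p) m = (if v \<in> keys m then lookup p (m - single v 1) else 0)"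
proof -
  have "Var v * p = (\<Sum>a\<in>keys p. single (single v 1 + a) (lookup p a))"
    using arg_cong[OF poly_mapping_sum_single[of p], of "\<lambda>q. Var v * q"]
    by (simp add: Var_def sum_distrib_left mult_single)
  then have eq: "lookup (Var v * p) m = (\<Sum>a\<in>keys p. if single v 1 + a = m then lookup p a else 0)"
    by (simp add: lookup_sum lookup_single when_def)
  show ?thesis
  proof (cases "v \<in> keys m")
    case True
    have "single v 1 + a = m \<longleftrightarrow> a = m - single v 1" for a
    proof
      assume "a = m - single v 1"
      then show "single v 1 + a = m"
        using True by (intro poly_mapping_eqI) (auto simp: lookup_add lookup_minus lookup_single when_def in_keys_iff)
    qed auto
    then show ?thesis
      using True eq by (simp add: in_keys_iff sum.delta)
  next
    case False
    have "single v 1 + a \<noteq> m" for a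
      using False by (auto simp: in_keys_iff lookup_add)
    then show ?thesis
      using False eq by simp
  qed
qed

lemma mon_degree_UNIV: "mon_degree (m :: 'v::finite \<Rightarrow>\<^sub>0 nat) = (\<Sum>x\<in>UNIV. lookup m x)"
  unfolding mon_degree_def by (intro sum.mono_neutral_left) (auto simp: in_keys_iff)

lemma mon_degree_add: "mon_degree (a + b :: 'v::finite \<Rightarrow>\<^sub>0 nat) = mon_degree a + mon_degree b"
  by (simp add: mon_degree_UNIV lookup_add sum.distrib)

lemma mon_degree_single [simp]: "mon_degree (single v n :: 'v::finite \<Rightarrow>\<^sub>0 nat) = n"
  by (simp add: mon_degree_def)

lemma finite_mon_degree: "finite {m :: 'v::finite \<Rightarrow>\<^sub>0 nat. int (mon_degree m) = j}"
proof -
  have "lookup ` {m :: 'v \<Rightarrow>\<^sub>0 nat. int (mon_degree m) = j} \<subseteq> {f. \<forall>x. f x \<in> {..nat j}}"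
  proof (clarsimp)
    fix m :: "'v \<Rightarrow>\<^sub>0 nat" and x
    show "lookup m x \<le> mon_degree m"
      unfolding mon_degree_UNIV by (rule member_le_sum) auto
  qed
  then have "finite (lookup ` {m :: 'v \<Rightarrow>\<^sub>0 nat. int (mon_degree m) = j})"
    by (rule finite_subset) (use finite_set_of_finite_funs[of "UNIV :: 'v set" "{..nat j}" undefined] in simp)
  then show ?thesis
    by (rule finite_imageD) (simp add: inj_on_def lookup_inject)
qed

section \<open>The grading of the polynomial ring\<close>

definition homs :: "int \<Rightarrow> ('v::finite, 'k::field) mpoly set" where
  "homs j = {p. homogeneous j p}"

lemma homogeneous_0 [simp]: "homogeneous s 0"
  by (simp add: homogeneous_def)

lemma homogeneous_add: "homogeneous s p \<Longrightarrow> homogeneous s q \<Longrightarrow> homogeneous s (p + q)"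
  unfolding homogeneous_def using keys_add[of p q] by blast

lemma homogeneous_uminus: "homogeneous s p \<Longrightarrow> homogeneous s (- p)"
  by (simp add: homogeneous_def in_keys_iff)

lemma homogeneous_diff: "homogeneous s p \<Longrightarrow> homogeneous s q \<Longrightarrow> homogeneous s (p - q)"
  using homogeneous_add[of s p "- q"] homogeneous_uminus[of s q] by simp

lemma homogeneous_sum: "(\<And>x. x \<in> A \<Longrightarrow> homogeneous s (f x)) \<Longrightarrow> homogeneous s (sum f A)"
  by (induction A rule: infinite_finite_induct) (auto intro: homogeneous_add)

lemma homogeneous_mult:
  assumes "homogeneous s (p :: ('v::finite, 'k::field) mpoly)" "homogeneous t q"
  shows "homogeneous (s + t) (p * q)"
  unfolding homogeneous_def
proof
  fix m assume "m \<in> keys (p * q)"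
  then obtain a b where "m = a + b" "a \<in> keys p" "b \<in> keys q"
    using keys_mult[of p q] by blast
  then show "int (mon_degree m) = s + t"
    using assms by (simp add: homogeneous_def mon_degree_add)
qed

lemma homogeneous_single: "int (mon_degree m) = s \<Longrightarrow> homogeneous s (single m c)"
  by (simp add: homogeneous_def)

lemma homogeneous_Var: "homogeneous 1 (Var v :: ('v::finite, 'k::field) mpoly)"
  unfolding Var_def by (rule homogeneous_single) simp

lemma homs_family: "graded_family (*) (homs :: int \<Rightarrow> ('v::finite, 'k::field) mpoly set)"
  unfolding graded_family_def homs_def
  using homogeneous_mult[OF homogeneous_Var, of _ ] 
  by (auto intro: homogeneous_add homogeneous_diff simp: add.commute)

section \<open>Ideal membership tested on monomials\<close>

lemma keys_mult_add:
  assumes "m \<in> keys (p * q :: ('v, 'k::field) mpoly)"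
  obtains a b where "m = a + b" "a \<in> keys p" "b \<in> keys q"
  using assms keys_mult[of p q] by blast

lemma keys_monomial_add: "keys (a + b :: 'v \<Rightarrow>\<^sub>0 nat) = keys a \<union> keys b"
  by (auto simp: in_keys_iff lookup_add)

lemma ideal_gen_minimal:
  assumes "S \<subseteq> J" "0 \<in> J" "\<And>x y. x \<in> J \<Longrightarrow> y \<in> J \<Longrightarrow> x + y \<in> J" "\<And>c x. x \<in> J \<Longrightarrow> c * x \<in> J"
  shows "ideal_gen S \<subseteq> J"
  unfolding ideal_gen_def
  by (rule module.span_minimal[OF module_mult assms(1)]) (auto intro: module.subspaceI[OF module_mult] assms)

lemma ideal_gen_mult: "x \<in> S \<Longrightarrow> c * x \<in> ideal_gen S"
  unfolding ideal_gen_def by (intro module.span_scale[OF module_mult] module.span_base[OF module_mult])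

lemma ideal_gen_sum: "(\<And>x. x \<in> A \<Longrightarrow> f x \<in> ideal_gen S) \<Longrightarrow> sum f A \<in> ideal_gen S"
  unfolding ideal_gen_def by (rule module.span_sum[OF module_mult])

text \<open>Every monomial other than 1 is divisible by a variable. Minimality of a resolution
  thereby becomes a condition on constant coefficients.\<close>

lemma irrelevant_ideal_eq: "irrelevant_ideal = {f :: ('v, 'k::field) mpoly. lookup f 0 = 0}"
proof
  show "irrelevant_ideal \<subseteq> {f :: ('v, 'k) mpoly. lookup f 0 = 0}"
    unfolding irrelevant_ideal_def
  proof (rule ideal_gen_minimal)
    fix c x :: "('v, 'k) mpoly"
    assume x: "x \<in> {f. lookup f 0 = 0}"
    have "0 \<notin> keys (c * x)"
    proof
      assume "0 \<in> keys (c * x)"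
      then obtain a b where ab: "0 = a + b" "b \<in> keys x"
        using keys_mult_add by blast
      have "keys (a + b) = {}"
        unfolding ab(1)[symmetric] by simp
      then have "b = 0"
        by (simp add: keys_monomial_add)
      then show False
        using ab x by (simp add: in_keys_iff)
    qed
    then show "c * x \<in> {f. lookup f 0 = 0}"
      by (simp add: in_keys_iff)
  next
    have "single v (1 :: nat) \<noteq> 0" for v :: 'v
      by (metis lookup_single_eq lookup_zero zero_neq_one)
    then show "range Var \<subseteq> {f :: ('v, 'k) mpoly. lookup f 0 = 0}"
      by (auto simp: Var_def lookup_single when_def)
  qed (auto simp: lookup_add)
  show "{f :: ('v, 'k) mpoly. lookup f 0 = 0} \<subseteq> irrelevant_ideal"
  proof
    fix f :: "('v, 'k) mpoly" assume f: "f \<in> {f. lookup f 0 = 0}"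
    have "single m (lookup f m) \<in> irrelevant_ideal" if m: "m \<in> keys f" for m
    proof -
      have "m \<noteq> 0"
        using m f by (auto simp: in_keys_iff)
      then obtain v where v: "v \<in> keys m"
        by (metis all_not_in_conv keys_eq_empty)
      have "m = (m - single v 1) + single v 1"
        using v by (intro poly_mapping_eqI) (auto simp: lookup_add lookup_minus lookup_single when_def in_keys_iff)
      then have "single m (lookup f m) = single (m - single v 1) (lookup f m) * Var v"
        by (metis Var_def mult.right_neutral mult_single)
      then show ?thesis
        unfolding irrelevant_ideal_def by (simp add: ideal_gen_mult)
    qed
    then show "f \<in> irrelevant_ideal"
      unfolding irrelevant_ideal_def by (subst poly_mapping_sum_single) (blast intro: ideal_gen_sum)
  qed
qed

text \<open>A monomial ideal contains a polynomial exactly when it contains each of its monomials.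
  Since the generators are squarefree, a monomial is tested by its support alone.\<close>

lemma edge_ideal_eq:
  assumes "simple_graph E"
  shows "edge_ideal E = {f :: ('v, 'k::field) mpoly. \<forall>m\<in>keys f. \<not> indep E (keys m)}"
proof
  show "edge_ideal E \<subseteq> {f :: ('v, 'k) mpoly. \<forall>m\<in>keys f. \<not> indep E (keys m)}"
    unfolding edge_ideal_def
  proof (rule ideal_gen_minimal)
    fix x y :: "('v, 'k) mpoly"
    assume "x \<in> {f. \<forall>m\<in>keys f. \<not> indep E (keys m)}" "y \<in> {f. \<forall>m\<in>keys f. \<not> indep E (keys m)}"
    then show "x + y \<in> {f. \<forall>m\<in>keys f. \<not> indep E (keys m)}"
      using keys_add[of x y] by auto
  next
    fix c x :: "('v, 'k) mpoly"
    assume "x \<in> {f. \<forall>m\<in>keys f. \<not> indep E (keys m)}"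
    then show "c * x \<in> {f. \<forall>m\<in>keys f. \<not> indep E (keys m)}"
      using indep_subset[OF _ Un_upper2] by (fastforce elim!: keys_mult_add simp: keys_monomial_add)
  next
    have "keys (Var x * Var y :: ('v, 'k) mpoly) = {single x 1 + single y 1}" for x y :: 'v
      by (simp add: Var_def mult_single)
    then show "{Var x * Var y |x y. {x, y} \<in> E} \<subseteq> {f :: ('v, 'k) mpoly. \<forall>m\<in>keys f. \<not> indep E (keys m)}"
      unfolding indep_def by (force simp: keys_monomial_add)
  qed simp
  show "{f :: ('v, 'k) mpoly. \<forall>m\<in>keys f. \<not> indep E (keys m)} \<subseteq> edge_ideal E"
  proof
    fix f :: "('v, 'k) mpoly" assume f: "f \<in> {f. \<forall>m\<in>keys f. \<not> indep E (keys m)}"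
    have "single m (lookup f m) \<in> edge_ideal E" if m: "m \<in> keys f" for m
    proof -
      obtain e where e: "e \<in> E" "e \<subseteq> keys m"
        using f m unfolding indep_def by blast
      then obtain x y where xy: "e = {x, y}" "x \<noteq> y"
        using assms unfolding simple_graph_def by (metis card_2_iff)
      define a where "a = single x 1 + (single y 1 :: 'v \<Rightarrow>\<^sub>0 nat)"
      have "m = (m - a) + a"
        using e xy by (intro poly_mapping_eqI)
          (auto simp: a_def lookup_add lookup_minus lookup_single when_def in_keys_iff)
      then have "single m (lookup f m) = single (m - a) (lookup f m) * single a 1"
        by (metis mult.right_neutral mult_single)
      also have "single a 1 = (Var x * Var y :: ('v, 'k) mpoly)"
        by (simp add: Var_def a_def mult_single)
      finally show ?thesis
        unfolding edge_ideal_def using e(1) xy(1) by (auto intro!: ideal_gen_mult)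
    qed
    then show "f \<in> edge_ideal E"
      unfolding edge_ideal_def by (subst poly_mapping_sum_single) (blast intro: ideal_gen_sum)
  qed
qed


section \<open>Multigraded strands of the Koszul complex\<close>

definition ind :: "'v::finite set \<Rightarrow> 'v \<Rightarrow>\<^sub>0 nat" where
  "ind S = (\<Sum>x\<in>S. single x 1)"

lemma lookup_ind: "lookup (ind S) x = (if x \<in> S then 1 else 0)"
  by (simp add: ind_def lookup_sum lookup_single when_def sum.delta)

lemma keys_ind [simp]: "keys (ind S) = S"
  by (auto simp: in_keys_iff lookup_ind split: if_splits)

lemma mon_degree_ind [simp]: "mon_degree (ind S) = card S"
  by (simp add: mon_degree_UNIV lookup_ind flip: sum.inter_filter)

lemma diff_ind_add: "S \<subseteq> keys m \<Longrightarrow> m - ind S + ind S = m"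
  by (intro poly_mapping_eqI) (auto simp: lookup_add lookup_minus lookup_ind in_keys_iff)

lemma mon_degree_diff_ind: "S \<subseteq> keys m \<Longrightarrow> int (mon_degree (m - ind S)) = int (mon_degree m) - int (card S)"
  using arg_cong[OF diff_ind_add, of S m mon_degree] by (simp add: mon_degree_add)

text \<open>\<open>bd\<close> with the variables stripped off: in a fixed multidegree the monomials
  are determined, and only scalar coefficients remain.\<close>

definition bdk :: "('v::finite set \<Rightarrow> 'k::comm_ring_1) \<Rightarrow> 'v set \<Rightarrow> 'k" where
  "bdk g T = (\<Sum>v\<in>-T. sg v T * g (insert v T))"

text \<open>The component of a chain in multidegree \<open>m\<close>: the basis element indexed by \<open>S\<close> itself has
  multidegree \<open>ind S\<close>.\<close>

definition strand :: "('v::finite set \<Rightarrow> ('v, 'k::field) mpoly) \<Rightarrow> ('v \<Rightarrow>\<^sub>0 nat) \<Rightarrow> 'v set \<Rightarrow> 'k" where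
  "strand c m S = (if S \<subseteq> keys m then lookup (c S) (m - ind S) else 0)"

text \<open>The way back from strands to chains, for finitely many multidegrees.\<close>

definition assemble :: "('v \<Rightarrow>\<^sub>0 nat) set \<Rightarrow> (('v \<Rightarrow>\<^sub>0 nat) \<Rightarrow> 'v::finite set \<Rightarrow> 'k::field) \<Rightarrow> 'v set \<Rightarrow> ('v, 'k) mpoly" where
  "assemble A g S = (\<Sum>m\<in>A. if S \<subseteq> keys m then single (m - ind S) (g m S) else 0)"

lemma lookup_strand: "lookup (c S) m = strand c (m + ind S) S"
  by (simp add: strand_def keys_monomial_add)

lemma strand_assemble:
  assumes "finite A"
  shows "strand (assemble A g) m S = (if m \<in> A \<and> S \<subseteq> keys m then g m S else 0)"
proof (cases "S \<subseteq> keys m")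
  case True
  have "lookup (if S \<subseteq> keys a then single (a - ind S) (g a S) else 0) (m - ind S) = (if a = m then g a S else 0)" for a
  proof (cases "S \<subseteq> keys a")
    case True
    have "a - ind S = m - ind S \<longleftrightarrow> a = m"
      using diff_ind_add[OF True] diff_ind_add[OF \<open>S \<subseteq> keys m\<close>] by metis
    then show ?thesis
      using True by (simp add: lookup_single when_def)
  qed (use True in auto)
  then show ?thesis
    using True assms by (simp add: strand_def assemble_def lookup_sum sum.delta)
qed (simp add: strand_def)

lemma lookup_sg_mult: "lookup (sg v T * p) m = sg v T * lookup (p :: ('v, 'k::field) mpoly) m"
  unfolding sg_def by (cases "even (card {u \<in> T. to_nat u < to_nat v})") simp_all

lemma strand_bd: "strand (bd (*) c) m T = bdk (strand c m) T"
proof (cases "T \<subseteq> keys m")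
  case True
  have "lookup (sg v T * Var v * c (insert v T)) (m - ind T) = sg v T * strand c m (insert v T)"
    if v: "v \<notin> T" for v
  proof -
    have "v \<in> keys (m - ind T) \<longleftrightarrow> v \<in> keys m"
      using v by (simp add: in_keys_iff lookup_minus lookup_ind)
    moreover have "m - ind T - single v 1 = m - ind (insert v T)"
      using v by (simp add: ind_def diff_diff_add add.commute)
    ultimately show ?thesis
      using True by (simp add: mult.assoc lookup_sg_mult lookup_Var_mult strand_def)
  qed
  then show ?thesis
    using True unfolding strand_def[of "bd (*) c"] bd_def bdk_def by (simp add: lookup_sum)
next
  case False
  then have "strand c m (insert v T) = 0" for v
    by (auto simp: strand_def)
  then show ?thesis
    using False by (simp add: bdk_def) (simp add: strand_def)
qed

lemma strand_nonzero:
  assumes "c \<in> kchains homs p j" "strand c m S \<noteq> 0"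
  shows "S \<subseteq> keys m" "card S = p" "int (mon_degree m) = j"
proof -
  show S: "S \<subseteq> keys m" and p: "card S = p"
    using assms(2) kchains_zero[OF assms(1), of S] by (force simp: strand_def split: if_splits)+
  have "m - ind S \<in> keys (c S)"
    using assms(2) S by (simp add: strand_def in_keys_iff)
  then show "int (mon_degree m) = j"
    using kchainsD[OF assms(1) p] mon_degree_diff_ind[OF S] p by (auto simp: homs_def homogeneous_def)
qed

lemma assemble_kchains:
  assumes "\<And>m. m \<in> A \<Longrightarrow> int (mon_degree m) = j"
    and "\<And>m S. m \<in> A \<Longrightarrow> g m S \<noteq> 0 \<Longrightarrow> card S = p"
  shows "assemble A g \<in> kchains homs p j"
proof (rule kchainsI)
  fix S :: "'a set"
  show "assemble A g S \<in> homs (j - int p)" if "card S = p"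
    unfolding homs_def assemble_def mem_Collect_eq
    using that assms(1) by (intro homogeneous_sum) (auto intro!: homogeneous_single simp: mon_degree_diff_ind)
  show "assemble A g S = 0" if "card S \<noteq> p"
    unfolding assemble_def using assms(2) that by (intro sum.neutral) (metis single_zero)
qed

text \<open>Coning with \<open>x\<close> contracts the strand, as long as the family of relevant sets is stable
  under removing \<open>x\<close>.\<close>

definition cone :: "'v::finite \<Rightarrow> ('v set \<Rightarrow> 'k::comm_ring_1) \<Rightarrow> 'v set \<Rightarrow> 'k" where
  "cone x g S = (if x \<in> S then sg x S * g (S - {x}) else 0)"

text \<open>The homotopy identity is \<open>bdk (cone x g) + cone x (bdk g) = g\<close>, and the
  hypothesis kills its second term at \<open>T\<close>. It is stated pointwise because modulo an
  ideal the cycle condition holds only at certain sets.\<close>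

lemma bdk_cone:
  assumes "x \<in> T \<Longrightarrow> bdk g (T - {x}) = 0"
  shows "bdk (cone x g) T = (g T :: 'k::comm_ring_1)"
proof (cases "x \<in> T")
  case False
  have "bdk (cone x g) T = sg x T * cone x g (insert x T) + (\<Sum>v\<in>-T - {x}. sg v T * cone x g (insert v T))"
    unfolding bdk_def using False by (intro sum.remove) auto
  also have "(\<Sum>v\<in>-T - {x}. sg v T * cone x g (insert v T)) = 0"
    using False by (intro sum.neutral) (auto simp: cone_def)
  also have "sg x T * cone x g (insert x T) = g T"
    using False by (simp add: cone_def mult.assoc[symmetric] sg_square)
  finally show ?thesis by simp
next
  case True
  define S where "S = T - {x}"
  have T: "T = insert x S" "x \<notin> S"
    using True by (auto simp: S_def)
  have signs: "sg v T * sg x (insert v T) = - (sg x S * sg v S :: 'k)" if "v \<notin> T" for v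
  proof -
    have v: "v \<noteq> x" "v \<notin> S" "to_nat v \<noteq> to_nat x"
      using that T by auto
    then show ?thesis
      unfolding T(1) using T(2)
      by (auto simp: sg_insert insert_commute[of v x])
  qed
  have "-S = insert x (-T)"
    using T by auto
  then have "0 = sg x S * g T + (\<Sum>v\<in>-T. sg v S * g (insert v S))"
    using assms[OF True] True T(1) unfolding S_def[symmetric] by (simp add: bdk_def)
  then have "sg x S * 0 = sg x S * (sg x S * g T + (\<Sum>v\<in>-T. sg v S * g (insert v S)))"
    by simp
  then have "0 = g T + (\<Sum>v\<in>-T. sg x S * sg v S * g (insert v S))"
    by (simp add: distrib_left mult.assoc[symmetric] sg_square sum_distrib_left)
  also have "(\<Sum>v\<in>-T. sg x S * sg v S * g (insert v S)) = - bdk (cone x g) T"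
    unfolding bdk_def sum_negf[symmetric]
  proof (rule sum.cong[OF refl])
    fix v assume "v \<in> -T"
    then have v: "v \<notin> T" "insert v T - {x} = insert v S"
      using T by auto
    then show "sg x S * sg v S * g (insert v S) = - (sg v T * cone x g (insert v T))"
      using True by (simp add: cone_def mult.assoc[symmetric] signs)
  qed
  finally show ?thesis by (simp add: algebra_simps)
qed

text \<open>A strand of nonzero multidegree is contracted by coning with any variable occurring in
  it. Multidegree 0 contains only the constant coefficient at \<open>{}\<close>, which
  \<open>const\<close> excludes.\<close>

lemma koszul_acyclic:
  fixes c :: "'v::finite set \<Rightarrow> ('v, 'k::field) mpoly"
  assumes c: "c \<in> kchains homs p j" and cycle: "\<And>T. bd (*) c T = 0" and const: "lookup (c {}) 0 = 0"
  shows "\<exists>h\<in>kchains homs (Suc p) j. \<forall>T. bd (*) h T = c T"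
proof -
  define x where "x m = (SOME x. x \<in> keys m)" for m :: "'v \<Rightarrow>\<^sub>0 nat"
  have x: "x m \<in> keys m" if "m \<noteq> 0" for m
    unfolding x_def some_in_eq using that by simp
  define A where "A = {m :: 'v \<Rightarrow>\<^sub>0 nat. int (mon_degree m) = j \<and> m \<noteq> 0}"
  have A: "finite A"
    unfolding A_def using finite_mon_degree[of j] by (rule rev_finite_subset) auto
  let ?g = "\<lambda>m. cone (x m) (strand c m)"
  let ?h = "assemble A ?g"
  have supp: "S \<subseteq> keys m \<and> card S = Suc p" if "?g m S \<noteq> 0" "m \<noteq> 0" for m S
  proof -
    from that have xS: "x m \<in> S" "strand c m (S - {x m}) \<noteq> 0"
      by (auto simp: cone_def split: if_splits)
    from strand_nonzero(1,2)[OF c xS(2)] show ?thesis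
      using xS(1) x[OF that(2)] card_Suc_Diff1[OF _ xS(1)] by auto
  qed
  have "strand (bd (*) ?h) m T = strand c m T" for m T
  proof (cases "m \<in> A")
    case True
    then have m: "m \<noteq> 0"
      by (simp add: A_def)
    have "strand ?h m = ?g m"
      using supp[OF _ m] True by (auto simp: strand_assemble[OF A] fun_eq_iff)
    then have "strand (bd (*) ?h) m T = bdk (?g m) T"
      by (simp add: strand_bd)
    also have "\<dots> = strand c m T"
      by (rule bdk_cone) (simp flip: strand_bd, simp add: cycle strand_def)
    finally show ?thesis .
  next
    case False
    have "strand c m T = 0"
    proof (rule ccontr)
      assume nz: "strand c m T \<noteq> 0"
      with False strand_nonzero(3)[OF c nz] have "m = 0"
        by (simp add: A_def)
      with nz show False
        using strand_nonzero(1)[OF c nz] const by (simp add: strand_def ind_def)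
    qed
    moreover have "strand ?h m = (\<lambda>_. 0)"
      using False by (auto simp: strand_assemble[OF A])
    ultimately show ?thesis
      by (simp add: strand_bd bdk_def)
  qed
  then have "bd (*) ?h T = c T" for T
    by (intro poly_mapping_eqI) (metis lookup_strand)
  moreover have "?h \<in> kchains homs (Suc p) j"
    by (rule assemble_kchains) (use supp in \<open>auto simp: A_def\<close>)
  ultimately show ?thesis
    by blast
qed


section \<open>Koszul homology of an edge ideal\<close>

definition edge_comp :: "'v::finite set set \<Rightarrow> int \<Rightarrow> ('v, 'k::field) mpoly set" where
  "edge_comp E j = {f \<in> edge_ideal E. homogeneous j f}"

definition supp_in :: "('v set \<Rightarrow> 'k::zero) \<Rightarrow> 'v set \<Rightarrow> nat \<Rightarrow> bool" where
  "supp_in g W p \<longleftrightarrow> (\<forall>S. g S \<noteq> 0 \<longrightarrow> S \<subseteq> W \<and> card S = p)"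

text \<open>The Koszul homology in multidegree \<open>m\<close> is nonzero: the basis elements are the sets \<open>S\<close> with
  \<open>m - ind S\<close> not in the ideal.\<close>

definition strand_tor :: "'k::field itself \<Rightarrow> 'v::finite set set \<Rightarrow> ('v \<Rightarrow>\<^sub>0 nat) \<Rightarrow> nat \<Rightarrow> bool" where
  "strand_tor K E m p \<longleftrightarrow> (\<exists>g :: 'v set \<Rightarrow> 'k. supp_in g (keys m) p \<and>
     (\<forall>T\<subseteq>keys m. indep E (keys (m - ind T)) \<longrightarrow> bdk g T = 0) \<and>
     \<not> (\<exists>h. supp_in h (keys m) (Suc p) \<and> (\<forall>S\<subseteq>keys m. indep E (keys (m - ind S)) \<longrightarrow> g S = bdk h S)))"

lemma strand_torE:
  assumes "strand_tor (K :: 'k::field itself) E m p"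
  obtains g :: "'v::finite set \<Rightarrow> 'k::field" where "supp_in g (keys m) p"
    "\<And>T. T \<subseteq> keys m \<Longrightarrow> indep E (keys (m - ind T)) \<Longrightarrow> bdk g T = 0"
    "\<And>h. supp_in h (keys m) (Suc p) \<Longrightarrow>
      \<not> (\<forall>S\<subseteq>keys m. indep E (keys (m - ind S)) \<longrightarrow> g S = bdk h S)"
proof -
  from assms obtain g :: "'v set \<Rightarrow> 'k" where "supp_in g (keys m) p"
    "\<forall>T\<subseteq>keys m. indep E (keys (m - ind T)) \<longrightarrow> bdk g T = 0"
    "\<nexists>h. supp_in h (keys m) (Suc p) \<and> (\<forall>S\<subseteq>keys m. indep E (keys (m - ind S)) \<longrightarrow> g S = bdk h S)"
    unfolding strand_tor_def by (elim exE conjE)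
  then show thesis
    by (intro that[of g]) simp_all
qed

lemma edge_ideal_strand:
  assumes "simple_graph E"
  shows "c S \<in> edge_ideal E \<longleftrightarrow> (\<forall>m. S \<subseteq> keys m \<longrightarrow> indep E (keys (m - ind S)) \<longrightarrow> strand c m S = 0)"
proof
  assume "c S \<in> edge_ideal E"
  then show "\<forall>m. S \<subseteq> keys m \<longrightarrow> indep E (keys (m - ind S)) \<longrightarrow> strand c m S = 0"
    by (auto simp: edge_ideal_eq[OF assms] strand_def in_keys_iff)
next
  assume *: "\<forall>m. S \<subseteq> keys m \<longrightarrow> indep E (keys (m - ind S)) \<longrightarrow> strand c m S = 0"
  show "c S \<in> edge_ideal E"
    unfolding edge_ideal_eq[OF assms]
  proof clarify
    fix m assume m: "m \<in> keys (c S)" "indep E (keys m)"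
    have "strand c (m + ind S) S = 0"
      using *[rule_format, of "m + ind S"] m(2) by (simp add: keys_monomial_add)
    then show False
      using m(1) by (simp add: in_keys_iff lookup_strand)
  qed
qed

lemma edge_ideal_diff: "x \<in> edge_ideal E \<Longrightarrow> y \<in> edge_ideal E \<Longrightarrow> x - y \<in> edge_ideal E"
  and edge_ideal_add: "x \<in> edge_ideal E \<Longrightarrow> y \<in> edge_ideal E \<Longrightarrow> x + y \<in> edge_ideal E"
  and edge_ideal_mult: "x \<in> edge_ideal E \<Longrightarrow> c * x \<in> edge_ideal E"
  and edge_ideal_0: "0 \<in> edge_ideal E"
  unfolding edge_ideal_def ideal_gen_def
  by (blast intro: module.span_diff[OF module_mult] module.span_add[OF module_mult]
      module.span_scale[OF module_mult] module.span_zero[OF module_mult])+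

lemma edge_comp_family: "graded_family (*) (edge_comp E :: int \<Rightarrow> ('v::finite, 'k::field) mpoly set)"
  using homs_family[where 'v = 'v and 'k = 'k]
  unfolding graded_family_def edge_comp_def homs_def
  by (auto intro: edge_ideal_0 edge_ideal_add edge_ideal_diff edge_ideal_mult)

lemma strand_diff: "strand (\<lambda>S. c S - c' S) m S = strand c m S - strand c' m S"
  by (simp add: strand_def lookup_minus)

text \<open>The ideal is spanned by monomials, so being a cycle or a boundary modulo it can be
  decided in each multidegree separately.\<close>

lemma tor_edge_ideal_strand:
  fixes E :: "'v::finite set set"
  assumes "simple_graph E"
  shows "tor (*) (homs :: int \<Rightarrow> ('v, 'k::field) mpoly set) (edge_comp E) p j \<longleftrightarrow>
    (\<exists>m. int (mon_degree m) = j \<and> strand_tor TYPE('k) E m p)"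
proof
  assume "tor (*) (homs :: int \<Rightarrow> ('v, 'k) mpoly set) (edge_comp E) p j"
  then obtain c :: "'v set \<Rightarrow> ('v, 'k) mpoly"
    where c: "c \<in> kchains homs p j" "\<And>T. bd (*) c T \<in> edge_comp E (j - int (card T))"
    and nb: "\<And>h. h \<in> kchains homs (Suc p) j \<Longrightarrow> \<not> (\<forall>S. c S - bd (*) h S \<in> edge_comp E (j - int (card S)))"
    unfolding tor_def by blast
  show "\<exists>m. int (mon_degree m) = j \<and> strand_tor TYPE('k) E m p"
  proof (rule ccontr)
    assume contra: "\<not> ?thesis"
    have "\<exists>h. supp_in h (keys m) (Suc p) \<and>
        (\<forall>S\<subseteq>keys m. indep E (keys (m - ind S)) \<longrightarrow> strand c m S = bdk h S)"
      if m: "int (mon_degree m) = j" for m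
    proof -
      have "supp_in (strand c m) (keys m) p"
        unfolding supp_in_def using strand_nonzero(1,2)[OF c(1)] by blast
      moreover have "\<forall>T\<subseteq>keys m. indep E (keys (m - ind T)) \<longrightarrow> bdk (strand c m) T = 0"
      proof (intro allI impI)
        fix T assume T: "T \<subseteq> keys m" "indep E (keys (m - ind T))"
        have "bd (*) c T \<in> edge_ideal E"
          using c(2) by (simp add: edge_comp_def)
        then have "strand (bd (*) c) m T = 0"
          using T by (subst (asm) edge_ideal_strand[OF assms]) blast
        then show "bdk (strand c m) T = 0"
          by (simp add: strand_bd)
      qed
      ultimately show ?thesis
        using contra m unfolding strand_tor_def by blast
    qed
    then obtain h where h: "\<And>m. int (mon_degree m) = j \<Longrightarrow> supp_in (h m) (keys m) (Suc p)"
      "\<And>m S. int (mon_degree m) = j \<Longrightarrow> S \<subseteq> keys m \<Longrightarrow> indep E (keys (m - ind S)) \<Longrightarrow> strand c m S = bdk (h m) S"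
      by metis
    let ?A = "{m :: 'v \<Rightarrow>\<^sub>0 nat. int (mon_degree m) = j}"
    \<comment> \<open>Only finitely many multidegrees have total degree \<open>j\<close>, so the
      separately chosen bounding strands form one polynomial chain.\<close>
    let ?h = "assemble ?A h"
    have H: "?h \<in> kchains homs (Suc p) j"
      by (rule assemble_kchains) (use h(1) in \<open>auto simp: supp_in_def\<close>)
    have hom: "homogeneous (j - int (card S)) (c S - bd (*) ?h S)" for S
      using kchains_diff[OF homs_family c(1) kchains_bd[OF module_mult homs_family H]]
      by (auto dest!: kchains_family[OF homs_family] simp: homs_def)
    have "c S - bd (*) ?h S \<in> edge_comp E (j - int (card S))" for S
    proof -
      have "strand c m S - strand (bd (*) ?h) m S = 0"
        if m: "S \<subseteq> keys m" "indep E (keys (m - ind S))" for m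
      proof (cases "m \<in> ?A")
        case True
        then have "strand ?h m = h m"
          using h(1)[of m] by (auto simp: strand_assemble[OF finite_mon_degree] fun_eq_iff supp_in_def)
        then show ?thesis
          using True h(2)[of m S] m by (simp add: strand_bd)
      next
        case False
        then have "strand ?h m = (\<lambda>_. 0)"
          by (auto simp: strand_assemble[OF finite_mon_degree])
        moreover have "strand c m S = 0"
          using strand_nonzero(3)[OF c(1), of m S] False by auto
        ultimately show ?thesis
          by (simp add: strand_bd bdk_def)
      qed
      then have "(\<lambda>S. c S - bd (*) ?h S) S \<in> edge_ideal E"
        by (subst edge_ideal_strand[OF assms]) (simp add: strand_diff)
      then show ?thesis
        using hom[of S] by (simp add: edge_comp_def)
    qed
    then show False
      using nb[OF H] by blast
  qed
next
  assume "\<exists>m. int (mon_degree m) = j \<and> strand_tor TYPE('k) E m p"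
  then obtain m where m: "int (mon_degree m) = j" and tor: "strand_tor TYPE('k) E m p"
    by blast
  obtain g :: "'v set \<Rightarrow> 'k" where g: "supp_in g (keys m) p"
      "\<And>T. T \<subseteq> keys m \<Longrightarrow> indep E (keys (m - ind T)) \<Longrightarrow> bdk g T = 0"
      and nb: "\<And>h. supp_in h (keys m) (Suc p) \<Longrightarrow>
        \<not> (\<forall>S\<subseteq>keys m. indep E (keys (m - ind S)) \<longrightarrow> g S = bdk h S)"
    using strand_torE[OF tor] by metis
  let ?c = "assemble {m} (\<lambda>_. g)"
  have c: "?c \<in> kchains homs p j"
    by (rule assemble_kchains) (use m g(1) in \<open>auto simp: supp_in_def\<close>)
  have strand_c: "strand ?c m' = (if m' = m then g else (\<lambda>_. 0))" for m'
    using g(1) by (auto simp: strand_assemble fun_eq_iff supp_in_def)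
  have "bd (*) ?c T \<in> edge_comp E (j - int (card T))" for T
  proof -
    have "bd (*) ?c T \<in> homs (j - int (card T))"
      by (rule bd_in_family[OF module_mult homs_family]) (rule kchains_family[OF homs_family c])
    moreover have "bd (*) ?c T \<in> edge_ideal E"
      by (subst edge_ideal_strand[OF assms]) (auto simp: strand_bd strand_c g(2) bdk_def[of "\<lambda>_. 0"])
    ultimately show ?thesis
      by (simp add: edge_comp_def homs_def)
  qed
  moreover have False
    if h: "h \<in> kchains homs (Suc p) j" "\<forall>S. ?c S - bd (*) h S \<in> edge_comp E (j - int (card S))" for h
  proof -
    have "supp_in (strand h m) (keys m) (Suc p)"
      unfolding supp_in_def using strand_nonzero(1,2)[OF h(1)] by blast
    moreover have "g S = bdk (strand h m) S" if S: "S \<subseteq> keys m" "indep E (keys (m - ind S))" for S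
    proof -
      have "(\<lambda>S. ?c S - bd (*) h S) S \<in> edge_ideal E"
        using h(2) by (simp add: edge_comp_def)
      then have "strand (\<lambda>S. ?c S - bd (*) h S) m S = 0"
        using S by (subst (asm) edge_ideal_strand[OF assms]) blast
      then show ?thesis
        by (simp add: strand_diff strand_bd strand_c)
    qed
    ultimately show False
      using nb by blast
  qed
  ultimately show "tor (*) (homs :: int \<Rightarrow> ('v, 'k) mpoly set) (edge_comp E) p j"
    unfolding tor_def using c by blast
qed

text \<open>When \<open>x\<close> has exponent at least 2, removing \<open>x\<close> from
  \<open>S\<close> does not change the support of \<open>m - ind S\<close>. The family of sets
  surviving modulo the ideal is thus stable under this removal, and coning with \<open>x\<close>
  contracts the strand.\<close>

lemma not_strand_tor_nonsquarefree:
  assumes "lookup m x \<ge> 2"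
  shows "\<not> strand_tor K (E :: 'v::finite set set) m p"
proof
  assume tor: "strand_tor K E m p"
  obtain g :: "'v set \<Rightarrow> 'a"
    where g: "supp_in g (keys m) p"
      "\<And>T. T \<subseteq> keys m \<Longrightarrow> indep E (keys (m - ind T)) \<Longrightarrow> bdk g T = 0"
      and nb: "\<And>h. supp_in h (keys m) (Suc p) \<Longrightarrow>
        \<not> (\<forall>S\<subseteq>keys m. indep E (keys (m - ind S)) \<longrightarrow> g S = bdk h S)"
    using strand_torE[OF tor] by metis
  have x: "x \<in> keys m"
    using assms by (simp add: in_keys_iff)
  have "supp_in (cone x g) (keys m) (Suc p)"
    unfolding supp_in_def
  proof (intro allI impI)
    fix S assume "cone x g S \<noteq> 0"
    then have "x \<in> S" "g (S - {x}) \<noteq> 0"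
      by (auto simp: cone_def split: if_splits)
    then show "S \<subseteq> keys m \<and> card S = Suc p"
      using g(1) x card_Suc_Diff1[of S x] unfolding supp_in_def by fastforce
  qed
  moreover have "g S = bdk (cone x g) S" if S: "S \<subseteq> keys m" "indep E (keys (m - ind S))" for S
  proof (rule bdk_cone[symmetric])
    have "keys (m - ind (S - {x})) = keys (m - ind S)"
      using assms by (auto simp: in_keys_iff lookup_minus lookup_ind split: if_splits)
    then show "bdk g (S - {x}) = 0"
      using S by (intro g(2)) auto
  qed
  ultimately show False
    using nb by blast
qed

text \<open>Passing to complements in \<open>W\<close> turns the Koszul differential into the simplicial coboundary,
  up to the sign of a permutation.\<close>

definition shuffle_sign :: "'v::finite set \<Rightarrow> 'v set \<Rightarrow> 'k::comm_ring_1" where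
  "shuffle_sign W T = (\<Prod>v\<in>T. sg v W)"

lemma shuffle_sign_square: "shuffle_sign W T * shuffle_sign W T = (1 :: 'k::comm_ring_1)"
  by (simp add: shuffle_sign_def sg_square flip: prod.distrib)

lemma sg_split:
  assumes "T \<subseteq> W"
  shows "sg v W = (sg v T * sg v (W - T) :: 'k::comm_ring_1)"
proof -
  have "{u \<in> W. to_nat u < to_nat v} = {u \<in> T. to_nat u < to_nat v} \<union> {u \<in> W - T. to_nat u < to_nat v}"
    using assms by auto
  then have "card {u \<in> W. to_nat u < to_nat v}
      = card {u \<in> T. to_nat u < to_nat v} + card {u \<in> W - T. to_nat u < to_nat v}"
    by (simp add: card_Un_disjoint disjoint_iff)
  then show ?thesis
    by (simp add: sg_def power_add)
qed

lemma cobd_complement: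
  assumes "T \<subseteq> W" and "\<And>S. g S \<noteq> 0 \<Longrightarrow> S \<subseteq> W"
  shows "cobd (\<lambda>T. shuffle_sign W T * g (W - T)) T = shuffle_sign W T * (bdk g (W - T) :: 'k::comm_ring_1)"
proof -
  have "bdk g (W - T) = (\<Sum>v\<in>T. sg v (W - T) * g (insert v (W - T)))"
    unfolding bdk_def
  proof (rule sum.mono_neutral_right)
    show "\<forall>v\<in>- (W - T) - T. sg v (W - T) * g (insert v (W - T)) = 0"
    proof
      fix v assume "v \<in> - (W - T) - T"
      then have "\<not> insert v (W - T) \<subseteq> W"
        by auto
      then have "g (insert v (W - T)) = 0"
        using assms(2) by blast
      then show "sg v (W - T) * g (insert v (W - T)) = 0"
        by simp
    qed
  qed (use assms(1) in auto)
  then have "shuffle_sign W T * bdk g (W - T) = (\<Sum>v\<in>T. shuffle_sign W T * sg v (W - T) * g (insert v (W - T)))"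
    by (simp add: sum_distrib_left mult.assoc)
  also have "\<dots> = cobd (\<lambda>T. shuffle_sign W T * g (W - T)) T"
    unfolding cobd_def
  proof (rule sum.cong[OF refl])
    fix v assume v: "v \<in> T"
    \<comment> \<open>Dropping \<open>v\<close> from the product costs \<open>sg v W\<close>, which
      \<open>sg_split\<close> factors into \<open>sg v T\<close> and \<open>sg v (W - T)\<close>;
      the second factor occurs twice and cancels.\<close>
    have "shuffle_sign W T * sg v (W - T) = sg v W * shuffle_sign W (T - {v}) * (sg v (W - T) :: 'k)"
      using v by (simp add: shuffle_sign_def prod.remove[of T v])
    also have "\<dots> = sg v T * shuffle_sign W (T - {v}) * (sg v (W - T) * sg v (W - T))"
      unfolding sg_split[OF assms(1)] by (simp only: mult_ac)
    also have "\<dots> = sg v T * shuffle_sign W (T - {v})"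
      by (simp add: sg_square)
    finally have "shuffle_sign W T * sg v (W - T) = (sg v T * shuffle_sign W (T - {v}) :: 'k)" .
    moreover have "insert v (W - T) = W - (T - {v})"
      using v assms(1) by auto
    ultimately show "shuffle_sign W T * sg v (W - T) * g (insert v (W - T))
        = sg v T * (shuffle_sign W (T - {v}) * g (W - (T - {v})))"
      by (simp add: mult.assoc)
  qed
  finally show ?thesis by simp
qed

text \<open>A set \<open>S\<close> survives modulo the ideal exactly when \<open>W - S\<close> is a
  face. Sets of size \<open>p\<close> thus correspond to faces of size \<open>card W - p\<close>,
  and lowering \<open>p\<close> raises the face size, so homology turns into cohomology. The bound
  on \<open>p\<close> guards the truncated subtraction.\<close>

lemma strand_tor_squarefree:
  fixes E :: "'v::finite set set"
  shows "strand_tor (K :: 'k::field itself) E (ind W) p \<longleftrightarrow> p \<le> card W \<and> coh K E W (card W - p)"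
proof -
  have alive: "keys (ind W - ind S) = W - S" for S :: "'v set"
    by (auto simp: in_keys_iff lookup_minus lookup_ind split: if_splits)
  let ?e = "shuffle_sign W :: 'v set \<Rightarrow> 'k"
  have cancel: "?e T * (?e T * c) = c" for T c
    by (simp add: shuffle_sign_square flip: mult.assoc)
  have card_compl: "card (W - S) = card W - card S" "card S \<le> card W" if "S \<subseteq> W" for S
    using that by (simp_all add: card_Diff_subset card_mono)
  show ?thesis
  proof (intro iffI conjI)
    assume tor: "strand_tor K E (ind W) p"
    obtain g :: "'v set \<Rightarrow> 'k" where g: "supp_in g W p"
      "\<And>T. T \<subseteq> W \<Longrightarrow> indep E (W - T) \<Longrightarrow> bdk g T = 0"
      and nb: "\<And>h. supp_in h W (Suc p) \<Longrightarrow> \<not> (\<forall>S\<subseteq>W. indep E (W - S) \<longrightarrow> g S = bdk h S)"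
      using strand_torE[OF tor, unfolded alive keys_ind] by metis
    show p: "p \<le> card W"
    proof (rule ccontr)
      assume "\<not> p \<le> card W"
      then have "g S = 0" for S
        using spec[OF g(1)[unfolded supp_in_def], of S] card_compl(2)[of S] by auto
      then show False
        using nb[of "\<lambda>_. 0"] by (simp add: supp_in_def bdk_def)
    qed
    let ?f = "\<lambda>T. ?e T * g (W - T)"
    have "cobd ?f T = 0" if T: "T \<subseteq> W" "indep E T" for T
    proof -
      have "cobd ?f T = ?e T * bdk g (W - T)"
        using g(1) by (intro cobd_complement[OF T(1)]) (simp add: supp_in_def)
      also have "bdk g (W - T) = 0"
        using T by (intro g(2)) (simp_all add: double_diff)
      finally show ?thesis by simp
    qed
    moreover have False
      if h: "\<forall>T\<subseteq>W. indep E T \<longrightarrow> card T = card W - p \<longrightarrow> ?f T = cobd h T" for h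
    proof -
      \<comment> \<open>\<open>h\<close> is arbitrary on irrelevant sets, whereas
        \<open>supp_in\<close> demands zero there. The cutoff does no harm: at the faces in question
        \<open>cobd\<close> reads only sets whose complements have size
        \<open>Suc p\<close>.\<close>
      define h' where "h' S = (if S \<subseteq> W \<and> card S = Suc p then ?e (W - S) * h (W - S) else 0)" for S
      have supp: "supp_in h' W (Suc p)"
        by (simp add: supp_in_def h'_def)
      have "g S = bdk h' S" if S: "S \<subseteq> W" "indep E (W - S)" for S
      proof (cases "card S = p")
        case True
        define T where "T = W - S"
        have T: "T \<subseteq> W" "W - T = S" "card T = card W - p" "indep E T"
          using S True card_compl[of S] by (auto simp: T_def)
        have "?e T * g S = cobd h T"
          using h T by auto
        also have "\<dots> = cobd (\<lambda>T. ?e T * h' (W - T)) T"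
        proof (rule cobd_cong)
          fix v assume v: "v \<in> T"
          have eq: "W - (T - {v}) = insert v S" "W - insert v S = T - {v}"
            using v subsetD[OF S(1)] by (auto simp: T_def)
          have "card (insert v S) = Suc p" "insert v S \<subseteq> W"
            using v True subsetD[OF S(1)] by (auto simp: T_def)
          then show "h (T - {v}) = ?e (T - {v}) * h' (W - (T - {v}))"
            unfolding eq(1) by (simp add: h'_def eq(2) cancel)
        qed
        also have "\<dots> = ?e T * bdk h' S"
          using supp cobd_complement[OF T(1), of h'] T(2) by (simp add: supp_in_def)
        finally show ?thesis
          using cancel by metis
      next
        case False
        then have "g S = 0"
          using g(1) by (auto simp: supp_in_def)
        moreover have "bdk h' S = 0"
          unfolding bdk_def h'_def using False by (intro sum.neutral) auto
        ultimately show ?thesis by simp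
      qed
      then show False
        using nb[OF supp] by blast
    qed
    ultimately show "coh K E W (card W - p)"
      unfolding coh_def by blast
  next
    assume "p \<le> card W \<and> coh K E W (card W - p)"
    then have p: "p \<le> card W" and coh: "coh K E W (card W - p)"
      by simp_all
    from coh obtain f :: "'v set \<Rightarrow> 'k"
      where f: "\<And>T. T \<subseteq> W \<Longrightarrow> indep E T \<Longrightarrow> card T = Suc (card W - p) \<Longrightarrow> cobd f T = 0"
      and nb: "\<nexists>h. \<forall>T\<subseteq>W. indep E T \<longrightarrow> card T = card W - p \<longrightarrow> f T = cobd h T"
      unfolding coh_def by auto
    define g where "g S = (if S \<subseteq> W \<and> card S = p then ?e (W - S) * f (W - S) else 0)" for S
    have supp: "supp_in g W p"
      by (simp add: supp_in_def g_def)
    have g: "?e T * g (W - T) = f T" if "T \<subseteq> W" "card T = card W - p" for T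
      using that p card_compl[of T] by (auto simp: g_def double_diff cancel)
    have "bdk g S = 0" if S: "S \<subseteq> W" "indep E (W - S)" for S
    proof (cases "Suc (card S) = p")
      case True
      define T where "T = W - S"
      have T: "T \<subseteq> W" "W - T = S" "card T = Suc (card W - p)" "indep E T"
        using S True card_compl[of S] p by (auto simp: T_def)
      have "?e T * bdk g S = cobd (\<lambda>T. ?e T * g (W - T)) T"
        using supp cobd_complement[OF T(1), of g] T(2) by (simp add: supp_in_def)
      also have "\<dots> = cobd f T"
      proof (rule cobd_cong)
        fix v assume "v \<in> T"
        then show "?e (T - {v}) * g (W - (T - {v})) = f (T - {v})"
          using T by (intro g) auto
      qed
      also have "\<dots> = 0"
        by (rule f[OF T(1,4,3)])
      finally show ?thesis
        using cancel[of T "bdk g S"] by auto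
    next
      case False
      then show ?thesis
        unfolding bdk_def g_def by (intro sum.neutral) auto
    qed
    moreover have False
      if h: "supp_in h W (Suc p)" "\<forall>S\<subseteq>W. indep E (W - S) \<longrightarrow> g S = bdk h S" for h
    proof -
      have "f T = cobd (\<lambda>T. ?e T * h (W - T)) T"
        if T: "T \<subseteq> W" "indep E T" "card T = card W - p" for T
      proof -
        have "cobd (\<lambda>T. ?e T * h (W - T)) T = ?e T * bdk h (W - T)"
          using h(1) T(1) by (intro cobd_complement) (auto simp: supp_in_def)
        also have "bdk h (W - T) = g (W - T)"
          using h(2) T by (simp add: double_diff)
        finally show ?thesis
          using g[OF T(1,3)] by simp
      qed
      then show False
        using nb by blast
    qed
    ultimately show "strand_tor K E (ind W) p"
      unfolding strand_tor_def alive keys_ind using supp by blast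
  qed
qed

lemma tor_edge_ideal:
  fixes E :: "'v::finite set set"
  assumes "simple_graph E"
  shows "tor (*) (homs :: int \<Rightarrow> ('v, 'k::field) mpoly set) (edge_comp E) p j \<longleftrightarrow>
    (\<exists>W. int (card W) = j \<and> p \<le> card W \<and> coh TYPE('k) E W (card W - p))"
  unfolding tor_edge_ideal_strand[OF assms]
proof
  assume "\<exists>m. int (mon_degree m) = j \<and> strand_tor TYPE('k) E m p"
  then obtain m where m: "int (mon_degree m) = j" "strand_tor TYPE('k) E m p"
    by blast
  have "lookup m x \<le> 1" for x
    using not_strand_tor_nonsquarefree[of m x "TYPE('k)" E p] m(2) by force
  then have "m = ind (keys m)"
    by (intro poly_mapping_eqI) (auto simp: lookup_ind in_keys_iff intro: le_antisym)
  then show "\<exists>W. int (card W) = j \<and> p \<le> card W \<and> coh TYPE('k) E W (card W - p)"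
    using m by (metis mon_degree_ind strand_tor_squarefree)
next
  assume "\<exists>W. int (card W) = j \<and> p \<le> card W \<and> coh TYPE('k) E W (card W - p)"
  then show "\<exists>m. int (mon_degree m) = j \<and> strand_tor TYPE('k) E m p"
    by (metis mon_degree_ind strand_tor_squarefree)
qed


section \<open>Graded free modules\<close>

abbreviation vscale where "vscale \<equiv> scale_vec"

definition fhoms :: "nat set \<Rightarrow> (nat \<Rightarrow> int) \<Rightarrow> int \<Rightarrow> (nat \<Rightarrow>\<^sub>0 ('v::finite, 'k::field) mpoly) set" where
  "fhoms B dg j = {v \<in> free_on B. \<forall>b. homogeneous (j - dg b) (lookup v b)}"

text \<open>By \<open>irrelevant_ideal_eq\<close>, this says that the vector lies in the irrelevant
  ideal times the free module.\<close>

definition free_const_zero :: "(nat \<Rightarrow>\<^sub>0 ('v::finite, 'k::field) mpoly) \<Rightarrow> bool" where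
  "free_const_zero v \<longleftrightarrow> (\<forall>b. lookup (lookup v b) 0 = 0)"

lemma fhoms_subset: "v \<in> fhoms B dg j \<Longrightarrow> v \<in> free_on B"
  by (simp add: fhoms_def)

lemma free_on_iff: "v \<in> free_on B \<longleftrightarrow> (\<forall>b. b \<notin> B \<longrightarrow> lookup v b = 0)"
  by (auto simp: free_on_def in_keys_iff)

lemma free_on_0: "0 \<in> free_on B"
  and free_on_add: "v \<in> free_on B \<Longrightarrow> w \<in> free_on B \<Longrightarrow> v + w \<in> free_on B"
  and free_on_diff: "v \<in> free_on B \<Longrightarrow> w \<in> free_on B \<Longrightarrow> v - w \<in> free_on B"
  and free_on_scale: "v \<in> free_on B \<Longrightarrow> vscale c v \<in> free_on B"
  by (simp_all add: free_on_iff lookup_add lookup_minus)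

lemma fhoms_family: "graded_family vscale (fhoms B dg :: int \<Rightarrow> (nat \<Rightarrow>\<^sub>0 ('v::finite, 'k::field) mpoly) set)"
  unfolding graded_family_def
proof (intro allI conjI ballI)
  fix j v and x :: "nat \<Rightarrow>\<^sub>0 ('v, 'k) mpoly" assume x: "x \<in> fhoms B dg j"
  have "homogeneous (j + 1 - dg b) (Var v * lookup x b)" for b
    using homogeneous_mult[OF homogeneous_Var, of "j - dg b" "lookup x b" v] x
    by (simp add: fhoms_def algebra_simps)
  then show "vscale (Var v) x \<in> fhoms B dg (j + 1)"
    using x by (simp add: fhoms_def free_on_scale)
qed (auto simp: fhoms_def free_on_0 free_on_add free_on_diff lookup_add lookup_minus
    intro: homogeneous_add homogeneous_diff)

lemma lookup_bd: "lookup (bd vscale c T) b = bd (*) (\<lambda>S. lookup (c S) b) T"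
  by (simp add: bd_def lookup_sum)

lemma lookup_sum_single:
  assumes "finite B"
  shows "lookup (\<Sum>b\<in>B. single b (f b)) b = (if b \<in> B then f b else 0)"
  using assms by (simp add: lookup_sum lookup_single when_def)

text \<open>The Koszul complex of a free module splits into copies of that of the ring, shifted by
  \<open>dg b\<close>; finiteness of \<open>B\<close> allows the coordinates to be put back into one
  vector.\<close>

lemma free_acyclic:
  assumes "finite B" and c: "c \<in> kchains (fhoms B dg) p j" and cycle: "\<And>T. bd vscale c T = 0"
    and const: "free_const_zero (c {})"
  shows "\<exists>h\<in>kchains (fhoms B dg) (Suc p) j. \<forall>T. bd vscale h T = c T"
proof -
  have comp: "(\<lambda>S. lookup (c S) b) \<in> kchains homs p (j - dg b)" for b
  proof (rule kchainsI)
    fix S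
    show "lookup (c S) b \<in> homs (j - dg b - int p)" if "card S = p"
      using kchainsD[OF c that] by (simp add: fhoms_def homs_def algebra_simps)
    show "lookup (c S) b = 0" if "card S \<noteq> p"
      using kchains_zero[OF c that] by simp
  qed
  have "\<exists>h\<in>kchains homs (Suc p) (j - dg b). \<forall>T. bd (*) h T = lookup (c T) b" for b
    by (rule koszul_acyclic[OF comp]) (use cycle const in \<open>simp_all add: free_const_zero_def flip: lookup_bd\<close>)
  then obtain h where h: "\<And>b. h b \<in> kchains homs (Suc p) (j - dg b)" "\<And>b T. bd (*) (h b) T = lookup (c T) b"
    by metis
  define h' where "h' S = (\<Sum>b\<in>B. single b (h b S))" for S
  have lookup_h': "lookup (h' S) b = (if b \<in> B then h b S else 0)" for S b
    by (simp add: h'_def lookup_sum_single[OF assms(1)])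
  have "h' \<in> kchains (fhoms B dg) (Suc p) j"
  proof (rule kchainsI)
    fix S
    show "h' S \<in> fhoms B dg (j - int (Suc p))" if "card S = Suc p"
      using kchainsD[OF h(1) that]
      by (auto simp: fhoms_def homs_def free_on_iff lookup_h' algebra_simps)
    show "h' S = 0" if "card S \<noteq> Suc p"
      using kchains_zero[OF h(1) that] by (simp add: h'_def)
  qed
  moreover have "bd vscale h' T = c T" for T
  proof (rule poly_mapping_eqI)
    fix b
    show "lookup (bd vscale h' T) b = lookup (c T) b"
    proof (cases "b \<in> B")
      case True
      then show ?thesis
        using h(2)[of b T] by (simp add: lookup_bd lookup_h')
    next
      case False
      have "c T \<in> fhoms B dg (j - int (card T))"
        by (rule kchains_family[OF fhoms_family c])
      then have "lookup (c T) b = 0"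
        using False by (simp add: fhoms_def free_on_iff)
      then show ?thesis
        using False unfolding lookup_bd lookup_h' by (simp add: bd_def)
    qed
  qed
  ultimately show ?thesis by blast
qed

lemma const_coeff_bd: "lookup (bd (*) c T) 0 = 0"
  by (simp add: bd_def lookup_sum mult.assoc lookup_sg_mult lookup_Var_mult)

text \<open>The minimal situation: a free cover of \<open>M / N\<close> whose kernel lies in the irrelevant ideal
  times the free module.\<close>

locale minimal_cover = graded_presentation vscale s2 \<phi> "fhoms B dg" M N Z
  for s2 :: "('v::finite, 'k::field) mpoly \<Rightarrow> 'm::ab_group_add \<Rightarrow> 'm"
    and \<phi> and B :: "nat set" and dg and M N :: "int \<Rightarrow> 'm set" and Z +
  assumes finite_B: "finite B"
    and minimal: "\<And>j z. z \<in> Z j \<Longrightarrow> free_const_zero z"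
begin

text \<open>Chains in positive homological degree vanish at \<open>{}\<close>, so
  \<open>free_acyclic\<close> applies to them at once. For cycles of \<open>Z\<close> in degree
  \<open>p = 0\<close>, minimality supplies the condition on constants.\<close>

lemma tor_Suc: "tor s2 M N (Suc p) j \<longleftrightarrow> tor vscale Z (\<lambda>_. {0}) p j"
proof (rule tor_syzygy)
  fix c assume c: "c \<in> kchains (fhoms B dg) (Suc p) j" "\<forall>T. bd vscale c T = 0"
  have "c {} = 0"
    by (rule kchains_zero[OF c(1)]) simp
  then show "\<exists>h\<in>kchains (fhoms B dg) (Suc (Suc p)) j. \<forall>T. bd vscale h T = c T"
    using c by (intro free_acyclic[OF finite_B]) (auto simp: free_const_zero_def)
next
  fix z assume z: "z \<in> kchains Z p j" "\<forall>T. bd vscale z T = 0"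
  have "free_const_zero (z {})"
    using kchains_family[OF Z_family z(1), of "{}"] by (rule minimal)
  moreover have "z \<in> kchains (fhoms B dg) p j"
    by (rule kchains_mono[OF z(1)]) (simp add: Z)
  ultimately show "\<exists>c\<in>kchains (fhoms B dg) (Suc p) j. \<forall>T. bd vscale c T = z T"
    using z(2) by (intro free_acyclic[OF finite_B]) auto
qed

lemma kchains_0: "x \<in> M' j \<Longrightarrow> (\<lambda>S :: 'v set. if S = {} then x else 0) \<in> kchains M' 0 j"
  by (rule kchainsI) (auto simp: card_eq_0_iff)

text \<open>Koszul homology in degree 0 is \<open>M\<close> modulo \<open>N\<close> and the
  irrelevant ideal times \<open>M\<close>. A minimal cover makes this the vector space on the basis
  \<open>B\<close>, with \<open>dg\<close> as degrees.\<close>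

lemma tor_0: "tor s2 M N 0 j \<longleftrightarrow> (\<exists>b\<in>B. dg b = j)"
proof
  assume "tor s2 M N 0 j"
  then obtain c where c: "c \<in> kchains M 0 j" 
    and nb: "\<And>h. h \<in> kchains M (Suc 0) j \<Longrightarrow> \<not> (\<forall>S. c S - bd s2 h S \<in> N (j - int (card S)))"
    unfolding tor_def by blast
  obtain c' where c': "c' \<in> kchains (fhoms B dg) 0 j" "\<And>S. c S - \<phi> (c' S) \<in> N (j - int (card S))"
    using lift_chain[OF c] by metis
  show "\<exists>b\<in>B. dg b = j"
  proof (rule ccontr)
    assume contra: "\<not> ?thesis"
    have c0: "c' {} \<in> fhoms B dg j"
      using kchainsD[OF c'(1), of "{}"] by simp
    have "free_const_zero (c' {})"
      unfolding free_const_zero_def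
    proof
      fix b
      show "lookup (lookup (c' {}) b) 0 = 0"
      proof (rule ccontr)
        assume nz: "lookup (lookup (c' {}) b) 0 \<noteq> 0"
        then have "b \<in> B"
          using c0 by (auto simp: fhoms_def free_on_iff)
        moreover have "int (mon_degree (0 :: 'v \<Rightarrow>\<^sub>0 nat)) = j - dg b"
          using c0 nz by (auto simp: fhoms_def homogeneous_def in_keys_iff)
        ultimately show False
          using contra by (auto simp: mon_degree_def)
      qed
    qed
    moreover have "bd vscale c' T = 0" for T
      using kchains_zero[OF c'(1)] by (auto simp: bd_def intro!: sum.neutral)
    ultimately obtain h where h: "h \<in> kchains (fhoms B dg) (Suc 0) j" "\<And>T. bd vscale h T = c' T"
      using free_acyclic[OF finite_B c'(1)] by blast
    have "c S - bd s2 (\<lambda>S. \<phi> (h S)) S \<in> N (j - int (card S))" for S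
      using c'(2) by (simp add: bd_hom[OF hom] h(2))
    then show False
      using nb[OF image_chain[OF h(1)]] by blast
  qed
next
  assume "\<exists>b\<in>B. dg b = j"
  then obtain b where b: "b \<in> B" "dg b = j"
    by blast
  have basis: "basis_vec b \<in> fhoms B dg j"
    using b by (auto simp: fhoms_def free_on_def lookup_single when_def homogeneous_def mon_degree_def)
  let ?c' = "\<lambda>S :: 'v set. if S = {} then basis_vec b else 0"
  let ?c = "\<lambda>S. \<phi> (?c' S)"
  have c': "?c' \<in> kchains (fhoms B dg) 0 j"
    by (rule kchains_0[where M' = "fhoms B dg" and j = j, OF basis])
  have "bd s2 ?c T = 0" for T
    by (auto simp: bd_def intro!: sum.neutral)
  then have "bd s2 ?c T \<in> N (j - int (card T))" for T
    using graded_family_0[OF N] by metis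
  moreover have False
    if h: "h \<in> kchains M (Suc 0) j" "\<forall>S. ?c S - bd s2 h S \<in> N (j - int (card S))" for h
  proof -
    obtain h' where h': "h' \<in> kchains (fhoms B dg) (Suc 0) j" "\<And>S. h S - \<phi> (h' S) \<in> N (j - int (card S))"
      using lift_chain[OF h(1)] by metis
    \<comment> \<open>Boundaries have no constant coefficients, so the entry of \<open>?z\<close> at
      \<open>b\<close> has constant term 1; yet \<open>?z\<close> lies in the kernel, against
      minimality.\<close>
    let ?z = "basis_vec b - bd vscale h' {}"
    have "bd s2 h {} - \<phi> (bd vscale h' {}) \<in> N j"
      using bd_in_family[OF m2.module_axioms N h'(2), of "{}"]
      by (simp add: bd_diff[OF m2.module_axioms] bd_hom[OF hom])
    moreover have "\<phi> (basis_vec b) - bd s2 h {} \<in> N j"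
      using h(2)[rule_format, of "{}"] by simp
    ultimately have "\<phi> (basis_vec b) - bd s2 h {} + (bd s2 h {} - \<phi> (bd vscale h' {})) \<in> N j"
      by (intro graded_family_add[OF N])
    moreover have "bd vscale h' {} \<in> fhoms B dg j"
      using kchainsD[OF kchains_bd[OF m1.module_axioms F h'(1)], of "{}"] by simp
    ultimately have "?z \<in> Z j"
      using graded_family_diff[OF F basis] by (simp add: Z diff)
    then have "lookup (lookup ?z b) 0 = 0"
      using minimal by (simp add: free_const_zero_def)
    then show False
      by (simp add: lookup_minus lookup_bd const_coeff_bd lookup_one)
  qed
  ultimately show "tor s2 M N 0 j"
    unfolding tor_def using image_chain[OF c'] by blast
qed

end


section \<open>Homogeneous components\<close>

definition compo :: "int \<Rightarrow> ('v::finite, 'k::field) mpoly \<Rightarrow> ('v, 'k) mpoly" where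
  "compo j p = (\<Sum>m\<in>keys p. if int (mon_degree m) = j then single m (lookup p m) else 0)"

lemma lookup_compo: "lookup (compo j p) m = (if int (mon_degree m) = j then lookup p m else 0)"
proof -
  have "lookup (compo j p) m = (\<Sum>m'\<in>keys p. if m' = m then if int (mon_degree m) = j then lookup p m else 0 else 0)"
    unfolding compo_def lookup_sum by (intro sum.cong refl) (auto simp: lookup_single when_def)
  then show ?thesis
    by (simp add: sum.delta in_keys_iff)
qed

lemma homogeneous_iff: "homogeneous j p \<longleftrightarrow> (\<forall>m. lookup p m \<noteq> 0 \<longrightarrow> int (mon_degree m) = j)"
  by (auto simp: homogeneous_def in_keys_iff)

lemma homogeneous_compo: "homogeneous j (compo j p)"
  by (simp add: homogeneous_iff lookup_compo)

lemma compo_homogeneous: "homogeneous j p \<Longrightarrow> compo j p = p"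
  by (intro poly_mapping_eqI) (auto simp: homogeneous_iff lookup_compo)

lemma compo_0 [simp]: "compo j 0 = 0"
  by (simp add: compo_def)

lemma compo_add: "compo j (p + q) = compo j p + compo j q"
  by (intro poly_mapping_eqI) (simp add: lookup_compo lookup_add)

lemma compo_diff: "compo j (p - q) = compo j p - compo j q"
  by (intro poly_mapping_eqI) (simp add: lookup_compo lookup_minus)

lemma compo_sum: "compo j (sum f A) = (\<Sum>x\<in>A. compo j (f x))"
  by (induction A rule: infinite_finite_induct) (simp_all add: compo_add)

lemma compo_mult:
  assumes "homogeneous s q"
  shows "compo j (p * q) = compo (j - s) p * q"
proof -
  have "compo j ((p - compo (j - s) p) * q) = 0"
  proof (rule poly_mapping_eqI)
    fix m
    have "m \<notin> keys ((p - compo (j - s) p) * q)" if deg: "int (mon_degree m) = j"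
    proof
      assume "m \<in> keys ((p - compo (j - s) p) * q)"
      then obtain a b where ab: "m = a + b" "a \<in> keys (p - compo (j - s) p)" "b \<in> keys q"
        by (rule keys_mult_add)
      then have "int (mon_degree b) = s" "int (mon_degree a) \<noteq> j - s"
        using assms by (auto simp: homogeneous_def in_keys_iff lookup_minus lookup_compo split: if_splits)
      then show False
        using deg ab(1) by (simp add: mon_degree_add)
    qed
    then show "lookup (compo j ((p - compo (j - s) p) * q)) m = lookup 0 m"
      by (simp add: lookup_compo in_keys_iff)
  qed
  moreover have "compo j (compo (j - s) p * q) = compo (j - s) p * q"
    using homogeneous_mult[OF homogeneous_compo assms, of "j - s" p] by (intro compo_homogeneous) simp
  ultimately show ?thesis
    using compo_diff[of j "p * q" "compo (j - s) p * q"] by (simp add: left_diff_distrib)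
qed

lemma edge_ideal_compo:
  assumes "simple_graph E" "p \<in> edge_ideal E"
  shows "compo j p \<in> edge_ideal E"
  using assms(2) unfolding edge_ideal_eq[OF assms(1)]
  by (auto simp: in_keys_iff lookup_compo split: if_splits)

definition vcompo :: "nat set \<Rightarrow> (nat \<Rightarrow> int) \<Rightarrow> int \<Rightarrow> (nat \<Rightarrow>\<^sub>0 ('v::finite, 'k::field) mpoly)
    \<Rightarrow> (nat \<Rightarrow>\<^sub>0 ('v, 'k) mpoly)" where
  "vcompo B dg j v = (\<Sum>b\<in>B. single b (compo (j - dg b) (lookup v b)))"

lemma lookup_vcompo:
  "finite B \<Longrightarrow> lookup (vcompo B dg j v) b = (if b \<in> B then compo (j - dg b) (lookup v b) else 0)"
  by (simp add: vcompo_def lookup_sum_single)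

lemma vcompo_fhoms: "finite B \<Longrightarrow> vcompo B dg j v \<in> fhoms B dg j"
  by (simp add: fhoms_def free_on_iff lookup_vcompo homogeneous_compo)

lemma vcompo_id: "finite B \<Longrightarrow> v \<in> fhoms B dg j \<Longrightarrow> vcompo B dg j v = v"
  by (intro poly_mapping_eqI) (auto simp: lookup_vcompo fhoms_def free_on_iff compo_homogeneous)

lemma hom_free_expand:
  assumes "module_hom vscale s \<phi>" "finite B" "v \<in> free_on B"
  shows "\<phi> v = (\<Sum>b\<in>B. s (lookup v b) (\<phi> (basis_vec b)))"
proof -
  interpret module_hom vscale s \<phi> by fact
  have "v = (\<Sum>b\<in>B. vscale (lookup v b) (basis_vec b))"
    using assms(2,3)
    by (intro poly_mapping_eqI) (auto simp: lookup_sum lookup_single when_def free_on_iff if_distrib cong: if_cong)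
  then have "\<phi> v = \<phi> (\<Sum>b\<in>B. vscale (lookup v b) (basis_vec b))"
    by simp
  then show ?thesis
    by (simp add: sum scale)
qed

lemma compo_augmentation:
  assumes "module_hom vscale (*) e" "finite B" "v \<in> free_on B"
    and "\<And>b. b \<in> B \<Longrightarrow> homogeneous (dg b) (e (basis_vec b))"
  shows "compo j (e v) = e (vcompo B dg j v)"
  by (simp add: hom_free_expand[OF assms(1-3)] hom_free_expand[OF assms(1,2) fhoms_subset[OF vcompo_fhoms[OF assms(2)]]]
      compo_sum compo_mult[OF assms(4)] lookup_vcompo[OF assms(2)] cong: sum.cong)

lemma vcompo_hom:
  assumes "module_hom vscale vscale d" "finite B'" "finite B" "v \<in> free_on B'" "d ` free_on B' \<subseteq> free_on B"
    and "\<And>b c. b \<in> B' \<Longrightarrow> c \<in> B \<Longrightarrow> homogeneous (dg' b - dg c) (lookup (d (basis_vec b)) c)"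
  shows "vcompo B dg j (d v) = d (vcompo B' dg' j v)"
proof (rule poly_mapping_eqI)
  fix c
  have w: "vcompo B' dg' j v \<in> free_on B'"
    by (rule fhoms_subset[OF vcompo_fhoms[OF assms(2)]])
  show "lookup (vcompo B dg j (d v)) c = lookup (d (vcompo B' dg' j v)) c"
  proof (cases "c \<in> B")
    case True
    have "compo (j - dg c) (lookup v b * lookup (d (basis_vec b)) c)
        = compo (j - dg' b) (lookup v b) * lookup (d (basis_vec b)) c" if "b \<in> B'" for b
      using compo_mult[OF assms(6)[OF that True], of "j - dg c" "lookup v b"] by simp
    then show ?thesis
      using True
      by (simp add: lookup_vcompo[OF assms(3)] lookup_vcompo[OF assms(2)] hom_free_expand[OF assms(1,2,4)]
          hom_free_expand[OF assms(1,2) w] lookup_sum compo_sum)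
  next
    case False
    have "d (vcompo B' dg' j v) \<in> free_on B"
      using assms(5) w by blast
    then show ?thesis
      using False by (simp add: lookup_vcompo[OF assms(3)] free_on_iff)
  qed
qed

definition zcomp :: "nat set \<Rightarrow> (nat \<Rightarrow> int) \<Rightarrow> (nat \<Rightarrow>\<^sub>0 ('v::finite, 'k::field) mpoly) set \<Rightarrow> int
    \<Rightarrow> (nat \<Rightarrow>\<^sub>0 ('v, 'k) mpoly) set" where
  "zcomp B dg Z j = fhoms B dg j \<inter> Z"

text \<open>\<open>e\<close> commutes with homogeneous components because it is homogeneous on basis
  vectors. The degree \<open>j\<close> component of any preimage is therefore a homogeneous
  preimage, and ungraded surjectivity modulo the ideal becomes graded.\<close>

lemma augmentation_cover:
  fixes E :: "'v::finite set set" and e :: "_ \<Rightarrow> ('v, 'k::field) mpoly"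
  assumes "simple_graph E" "module_hom vscale (*) e" "finite B"
    and "\<And>b. b \<in> B \<Longrightarrow> homogeneous (dg b) (e (basis_vec b))"
    and "\<And>f. \<exists>v\<in>free_on B. f - e v \<in> edge_ideal E"
    and "\<And>v. v \<in> free_on B \<Longrightarrow> e v \<in> edge_ideal E \<Longrightarrow> free_const_zero v"
  shows "minimal_cover (*) e B dg homs (edge_comp E) (zcomp B dg {v \<in> free_on B. e v \<in> edge_ideal E})"
proof (intro minimal_cover.intro graded_presentation.intro minimal_cover_axioms.intro)
  show "e x \<in> homs j" if "x \<in> fhoms B dg j" for j x
    using compo_augmentation[OF assms(2,3) fhoms_subset[OF that] assms(4), of j]
      vcompo_id[OF assms(3) that] homogeneous_compo[of j "e x"] by (simp add: homs_def)
  then show "zcomp B dg {v \<in> free_on B. e v \<in> edge_ideal E} j = {f \<in> fhoms B dg j. e f \<in> edge_comp E j}" for j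
    by (auto simp: zcomp_def edge_comp_def homs_def dest: fhoms_subset)
  fix j and m :: "('v, 'k) mpoly" assume m: "m \<in> homs j"
  obtain v where v: "v \<in> free_on B" "m - e v \<in> edge_ideal E"
    using assms(5) by blast
  have eq: "compo j (m - e v) = m - e (vcompo B dg j v)"
    using m by (simp add: compo_diff compo_augmentation[OF assms(2,3) v(1) assms(4)] compo_homogeneous homs_def)
  have "m - e (vcompo B dg j v) \<in> edge_comp E j"
    using edge_ideal_compo[OF assms(1) v(2), of j] homogeneous_compo[of j "m - e v"]
    unfolding eq edge_comp_def by simp
  then show "\<exists>f\<in>fhoms B dg j. m - e f \<in> edge_comp E j"
    using vcompo_fhoms[OF assms(3)] by blast
qed (use assms fhoms_family homs_family edge_comp_family in
    \<open>auto simp: edge_comp_def homs_def zcomp_def\<close>)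

text \<open>The same passage to components for a differential. The module covered is the syzygy
  module \<open>Z\<close> itself, so the second family is zero.\<close>

lemma differential_cover:
  fixes d :: "(nat \<Rightarrow>\<^sub>0 ('v::finite, 'k::field) mpoly) \<Rightarrow> _"
  assumes "module_hom vscale vscale d" "finite B'" "finite B" "Z \<subseteq> free_on B" "module.subspace vscale Z"
    and "d ` free_on B' = Z"
    and "\<And>b c. b \<in> B' \<Longrightarrow> c \<in> B \<Longrightarrow> homogeneous (dg' b - dg c) (lookup (d (basis_vec b)) c)"
    and "\<And>v. v \<in> free_on B' \<Longrightarrow> d v = 0 \<Longrightarrow> free_const_zero v"
  shows "minimal_cover vscale d B' dg' (zcomp B dg Z) (\<lambda>_. {0}) (zcomp B' dg' {v \<in> free_on B'. d v = 0})"
proof (intro minimal_cover.intro graded_presentation.intro minimal_cover_axioms.intro)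
  have vc: "vcompo B dg j (d v) = d (vcompo B' dg' j v)" if "v \<in> free_on B'" for v j
    using assms(4,6) by (intro vcompo_hom[OF assms(1,2,3) that _ assms(7)]) auto
  show "d x \<in> zcomp B dg Z j" if "x \<in> fhoms B' dg' j" for j x
    using vc[OF fhoms_subset[OF that], of j] vcompo_id[OF assms(2) that] vcompo_fhoms[OF assms(3), of dg j "d x"]
      fhoms_subset[OF that] assms(6) by (auto simp: zcomp_def)
  show "\<exists>f\<in>fhoms B' dg' j. m - d f \<in> {0}" if m: "m \<in> zcomp B dg Z j" for j m
  proof -
    obtain v where v: "v \<in> free_on B'" "m = d v"
      using m assms(6) by (auto simp: zcomp_def)
    then have "m = d (vcompo B' dg' j v)"
      using vc[OF v(1), of j] vcompo_id[OF assms(3), of m dg j] m by (simp add: zcomp_def)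
    then show ?thesis
      using vcompo_fhoms[OF assms(2), of dg' j v] by auto
  qed
qed (use assms fhoms_family graded_family_zero[OF module_scale_vec] in
    \<open>auto simp: zcomp_def dest: fhoms_subset\<close>)

text \<open>Each step of the resolution minimally covers the preceding syzygy module. Repeated use
  of \<open>tor_Suc\<close> shifts down to homological degree 0, where \<open>tor_0\<close> reads
  off the basis \<open>B i\<close>.\<close>

lemma resolution_tor:
  fixes E :: "'v::finite set set"
  assumes "simple_graph E" "minimal_graded_free_resolution (edge_ideal E :: ('v, 'k::field) mpoly set) B deg e d"
  shows "(\<exists>b\<in>B i. deg i b = j) \<longleftrightarrow> tor (*) (homs :: int \<Rightarrow> ('v, 'k) mpoly set) (edge_comp E) i j"
proof -
  let ?I = "edge_ideal E :: ('v, 'k) mpoly set"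
  define Z where "Z i = (case i of 0 \<Rightarrow> {v \<in> free_on (B 0). e v \<in> ?I}
    | Suc i \<Rightarrow> {v \<in> free_on (B (Suc i)). d i v = 0})" for i
  from assms(2) have fin: "\<And>i. finite (B i)"
    and ex: "exact_resolution ?I (\<lambda>i. free_on (B i)) e d"
    and homs_e: "\<And>b. b \<in> B 0 \<Longrightarrow> homogeneous (deg 0 b) (e (basis_vec b))"
    and homs_d: "\<And>i b c. b \<in> B (Suc i) \<Longrightarrow> c \<in> B i \<Longrightarrow>
      homogeneous (deg (Suc i) b - deg i c) (lookup (d i (basis_vec b)) c)"
    and min: "\<And>i v c. v \<in> free_on (B (Suc i)) \<Longrightarrow> c \<in> B i \<Longrightarrow> lookup (d i v) c \<in> irrelevant_ideal"
    unfolding minimal_graded_free_resolution_def by blast+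
  from ex have hom_e: "module_hom vscale (*) e" and hom_d: "\<And>i. module_hom vscale vscale (d i)"
    and surj: "\<And>f. \<exists>v\<in>free_on (B 0). f - e v \<in> ?I"
    unfolding exact_resolution_def by blast+
  from ex have im: "d i ` free_on (B (Suc i)) = Z i" for i
    unfolding exact_resolution_def Z_def by (cases i) auto
  have Z_sub: "Z i \<subseteq> free_on (B i)" for i
    unfolding Z_def by (cases i) auto
  \<comment> \<open>By exactness a syzygy is the image of the next differential, whose entries lie
    in the irrelevant ideal.\<close>
  have const: "free_const_zero z" if z: "z \<in> Z i" for z i
  proof -
    obtain v where v: "v \<in> free_on (B (Suc i))" "z = d i v"
      using z im by blast
    have "lookup (lookup z b) 0 = 0" for b
      using min[OF v(1), of b] v(2) z Z_sub[of i]
      by (cases "b \<in> B i") (auto simp: irrelevant_ideal_eq free_on_iff)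
    then show ?thesis
      by (simp add: free_const_zero_def)
  qed
  have subspace_Z: "module.subspace vscale (Z i)" for i
  proof -
    interpret h: module_hom vscale vscale "d i"
      by (rule hom_d)
    have "h.m1.subspace (free_on (B (Suc i)))"
      by (rule h.m1.subspaceI) (auto intro: free_on_0 free_on_add free_on_scale)
    then show ?thesis
      using h.subspace_image im by metis
  qed
  have cover0: "minimal_cover (*) e (B 0) (deg 0) homs (edge_comp E) (zcomp (B 0) (deg 0) (Z 0))"
    unfolding Z_def nat.case
    by (rule augmentation_cover[OF assms(1) hom_e fin homs_e surj]) (auto intro: const[of _ 0] simp: Z_def)
  have coverS: "minimal_cover vscale (d i) (B (Suc i)) (deg (Suc i)) (zcomp (B i) (deg i) (Z i)) (\<lambda>_. {0})
      (zcomp (B (Suc i)) (deg (Suc i)) (Z (Suc i)))" for i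
    unfolding Z_def[of "Suc i"] nat.case
    by (rule differential_cover[OF hom_d fin fin Z_sub subspace_Z im homs_d])
       (auto intro: const[of _ "Suc i"] simp: Z_def)
  \<comment> \<open>\<open>p\<close> has to vary in the induction: a step to the next syzygy module
    trades one unit of \<open>i\<close> for one unit of \<open>p\<close>.\<close>
  have shift: "tor vscale (zcomp (B i) (deg i) (Z i)) (\<lambda>_. {0}) p j \<longleftrightarrow>
      tor (*) (homs :: int \<Rightarrow> ('v, 'k) mpoly set) (edge_comp E) (Suc (i + p)) j" for i p
  proof (induction i arbitrary: p)
    case 0
    then show ?case
      using minimal_cover.tor_Suc[OF cover0] by simp
  next
    case (Suc i)
    show ?case
      using Suc.IH[of "Suc p"] minimal_cover.tor_Suc[OF coverS, of i p j] by simp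
  qed
  show ?thesis
  proof (cases i)
    case 0
    then show ?thesis
      using minimal_cover.tor_0[OF cover0] by simp
  next
    case (Suc i')
    then show ?thesis
      using minimal_cover.tor_0[OF coverS] shift[of i' 0] by simp
  qed
qed


section \<open>Existence of a minimal graded free resolution\<close>

text \<open>\<open>C\<close> represents a basis of \<open>V / U\<close>: extend a basis of
  \<open>U\<close> to one of \<open>V\<close> and keep the new vectors.\<close>

lemma (in vector_space) finite_complement:
  assumes "finite G" "V \<subseteq> span G" "subspace U" "subspace V" "U \<subseteq> V"
  shows "\<exists>C. finite C \<and> C \<subseteq> V \<and> (\<forall>v\<in>V. \<exists>a. v - (\<Sum>c\<in>C. a c *s c) \<in> U) \<and>
    (\<forall>a. (\<Sum>c\<in>C. a c *s c) \<in> U \<longrightarrow> (\<forall>c\<in>C. a c = 0))"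
proof -
  obtain A where A: "A \<subseteq> U" "independent A" "U \<subseteq> span A"
    using maximal_independent_subset by blast
  obtain D where D: "A \<subseteq> D" "D \<subseteq> V" "independent D" "V \<subseteq> span D"
    using maximal_independent_subset_extend[of A V] A assms(5) by blast
  have finD: "finite D"
    using independent_span_bound[OF assms(1) D(3)] D(2) assms(2) by blast
  have U_sum: "\<exists>r. u = (\<Sum>c\<in>A. r c *s c)" if "u \<in> U" for u
    using that A(3) span_finite[OF finite_subset[OF D(1) finD]] by auto
  have split: "(\<Sum>c\<in>D. r c *s c) = (\<Sum>c\<in>A. r c *s c) + (\<Sum>c\<in>D - A. r c *s c)" for r
    using sum.subset_diff[OF D(1) finD, of "\<lambda>c. r c *s c"] by (simp add: add.commute)
  show ?thesis
  proof (intro exI[of _ "D - A"] conjI ballI allI impI)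
    fix v assume "v \<in> V"
    then obtain r where "v = (\<Sum>c\<in>D. r c *s c)"
      using D(4) span_finite[OF finD] by auto
    then have "v - (\<Sum>c\<in>D - A. r c *s c) = (\<Sum>c\<in>A. r c *s c)"
      by (simp add: split)
    also have "\<dots> \<in> U"
      using A(1) by (intro subspace_sum[OF assms(3)] subspace_scale[OF assms(3)]) auto
    finally show "\<exists>a. v - (\<Sum>c\<in>D - A. a c *s c) \<in> U"
      by blast
  next
    fix a c assume a: "(\<Sum>c\<in>D - A. a c *s c) \<in> U" and c: "c \<in> D - A"
    obtain r where r: "(\<Sum>c\<in>D - A. a c *s c) = (\<Sum>c\<in>A. r c *s c)"
      using U_sum[OF a] by blast
    define t where "t c = (if c \<in> A then - r c else a c)" for c
    have "(\<Sum>c\<in>A. t c *s c) = - (\<Sum>c\<in>A. r c *s c)"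
      by (simp add: t_def scale_minus_left sum_negf)
    moreover have "(\<Sum>c\<in>D - A. t c *s c) = (\<Sum>c\<in>D - A. a c *s c)"
      by (intro sum.cong) (auto simp: t_def)
    ultimately have "(\<Sum>c\<in>D. t c *s c) = 0"
      by (simp add: split r)
    then have "t c = 0"
      using independentD[OF D(3) finD subset_refl] c by blast
    then show "a c = 0"
      using c by (simp add: t_def)
  qed (use finD D(2) in auto)
qed

text \<open>Homogeneous components are not submodules over the polynomial ring, but they are vector
  spaces over the field of constants. Choosing minimal generators is linear algebra in them.\<close>

definition kscale :: "'k::field \<Rightarrow> (nat \<Rightarrow>\<^sub>0 ('v::finite, 'k) mpoly) \<Rightarrow> (nat \<Rightarrow>\<^sub>0 ('v, 'k) mpoly)" where
  "kscale c v = vscale (single 0 c) v"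

interpretation kvec: vector_space "kscale :: 'k::field \<Rightarrow> (nat \<Rightarrow>\<^sub>0 ('v::finite, 'k) mpoly) \<Rightarrow> _"
proof -
  interpret module "vscale :: ('v, 'k) mpoly \<Rightarrow> _"
    by (rule module_scale_vec)
  show "vector_space (kscale :: 'k \<Rightarrow> (nat \<Rightarrow>\<^sub>0 ('v, 'k) mpoly) \<Rightarrow> _)"
    by unfold_locales
      (simp_all add: kscale_def scale_right_distrib scale_left_distrib mult_single single_add)
qed

lemma vscale_single: "vscale c (single b p) = single b (c * p)"
  by (intro poly_mapping_eqI) (simp add: lookup_single when_def)

lemma fhoms_finite_span:
  assumes "finite B"
  obtains G :: "(nat \<Rightarrow>\<^sub>0 ('v::finite, 'k::field) mpoly) set" where "finite G" "fhoms B dg j \<subseteq> kvec.span G"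
proof -
  define G :: "(nat \<Rightarrow>\<^sub>0 ('v, 'k) mpoly) set"
    where "G = (\<Union>b\<in>B. (\<lambda>m. single b (single m 1)) ` {m. int (mon_degree m) = j - dg b})"
  have "finite G"
    unfolding G_def using assms by (intro finite_UN_I finite_imageI finite_mon_degree)
  moreover have "v \<in> kvec.span G" if v: "v \<in> fhoms B dg j" for v
  proof -
    have "v = (\<Sum>b\<in>keys v. \<Sum>m\<in>keys (lookup v b). kscale (lookup (lookup v b) m) (single b (single m 1)))"
    proof -
      have single_sum: "single b (sum f A) = (\<Sum>m\<in>A. single b (f m))" for b :: nat and f :: "('v \<Rightarrow>\<^sub>0 nat) \<Rightarrow> ('v, 'k) mpoly" and A
        by (induction A rule: infinite_finite_induct) (simp_all add: single_add)
      have "single b (lookup v b)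
          = (\<Sum>m\<in>keys (lookup v b). kscale (lookup (lookup v b) m) (single b (single m 1)))" for b
      proof -
        have "single b (lookup v b) = single b (\<Sum>m\<in>keys (lookup v b). single m (lookup (lookup v b) m))"
          by (rule arg_cong[OF poly_mapping_sum_single])
        also have "\<dots> = (\<Sum>m\<in>keys (lookup v b). kscale (lookup (lookup v b) m) (single b (single m 1)))"
          by (simp add: single_sum kscale_def vscale_single mult_single)
        finally show ?thesis .
      qed
      then have "(\<Sum>b\<in>keys v. single b (lookup v b))
          = (\<Sum>b\<in>keys v. \<Sum>m\<in>keys (lookup v b). kscale (lookup (lookup v b) m) (single b (single m 1)))"
        by (intro sum.cong refl)
      with poly_mapping_sum_single show ?thesis
        by (rule trans)
    qed
    also have "\<dots> \<in> kvec.span G"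
    proof (intro kvec.span_sum kvec.span_scale kvec.span_base)
      fix b m assume b: "b \<in> keys v" "m \<in> keys (lookup v b)"
      then have "b \<in> B" "int (mon_degree m) = j - dg b"
        using v by (auto simp: fhoms_def free_on_def homogeneous_def)
      then show "single b (single m 1) \<in> G"
        by (auto simp: G_def)
    qed
    finally show ?thesis .
  qed
  ultimately show thesis
    using that by blast
qed

text \<open>The degree \<open>j\<close> part of the irrelevant ideal times \<open>M\<close>.
  Elements of \<open>M (j - 1)\<close> suffice as coefficients because the variables generate that
  ideal in degree 1.\<close>

definition irr :: "(int \<Rightarrow> (nat \<Rightarrow>\<^sub>0 ('v::finite, 'k::field) mpoly) set) \<Rightarrow> int \<Rightarrow> (nat \<Rightarrow>\<^sub>0 ('v, 'k) mpoly) set" where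
  "irr M j = {\<Sum>v\<in>UNIV. vscale (Var v) (f v) | f. \<forall>v. f v \<in> M (j - 1)}"

text \<open>An element \<open>z\<close> placed at \<open>{}\<close> is a cycle in homological degree
  0, and being a boundary means being a combination of the variables.\<close>

lemma irr_if_not_tor:
  fixes M :: "int \<Rightarrow> (nat \<Rightarrow>\<^sub>0 ('v::finite, 'k::field) mpoly) set"
  assumes "\<not> tor vscale M (\<lambda>_. {0}) 0 j" "z \<in> M j"
  shows "z \<in> irr M j"
proof -
  interpret module "vscale :: ('v, 'k) mpoly \<Rightarrow> _"
    by (rule module_scale_vec)
  let ?c = "\<lambda>S :: 'v set. if S = {} then z else 0"
  have "?c \<in> kchains M 0 j"
    by (rule kchainsI) (auto simp: card_eq_0_iff assms(2))
  moreover have "bd vscale ?c T = 0" for T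
    by (auto simp: bd_def intro!: sum.neutral)
  ultimately obtain h where h: "h \<in> kchains M (Suc 0) j" "\<And>S. ?c S - bd vscale h S = 0"
    using assms(1) unfolding tor_def by auto
  have "z = bd vscale h {}"
    using h(2)[of "{}"] by simp
  also have "\<dots> = (\<Sum>v\<in>UNIV. vscale (Var v) (h {v}))"
    by (simp add: bd_def)
  finally show ?thesis
    unfolding irr_def using kchainsD[OF h(1)] by force
qed

lemma zcomp_kspace:
  fixes Z :: "(nat \<Rightarrow>\<^sub>0 ('v::finite, 'k::field) mpoly) set"
  assumes "module.subspace vscale Z"
  shows "kvec.subspace (zcomp B dg Z j)"
proof (rule kvec.subspaceI)
  interpret module "vscale :: ('v, 'k) mpoly \<Rightarrow> _"
    by (rule module_scale_vec)
  note fam = fhoms_family[of B dg, where 'v = 'v and 'k = 'k]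
  show "0 \<in> zcomp B dg Z j"
    using subspace_0[OF assms] graded_family_0[OF fam] by (simp add: zcomp_def)
  fix x y assume x: "x \<in> zcomp B dg Z j"
  show "x + y \<in> zcomp B dg Z j" if "y \<in> zcomp B dg Z j"
    using x that subspace_add[OF assms] graded_family_add[OF fam] by (simp add: zcomp_def)
  fix c
  have "homogeneous (j - dg b) (single 0 c * lookup x b)" for b
    using homogeneous_mult[OF homogeneous_single[of 0 0 c], of "j - dg b" "lookup x b"] x
    by (simp add: zcomp_def fhoms_def mon_degree_def)
  then show "kscale c x \<in> zcomp B dg Z j"
    using x subspace_scale[OF assms] by (simp add: zcomp_def fhoms_def kscale_def free_on_scale)
qed

lemma irr_kspace:
  fixes M :: "int \<Rightarrow> (nat \<Rightarrow>\<^sub>0 ('v::finite, 'k::field) mpoly) set"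
  assumes "kvec.subspace (M (j - 1))"
  shows "kvec.subspace (irr M j)"
proof (rule kvec.subspaceI)
  interpret module "vscale :: ('v, 'k) mpoly \<Rightarrow> _"
    by (rule module_scale_vec)
  show "0 \<in> irr M j"
    unfolding irr_def using kvec.subspace_0[OF assms] by (auto intro!: exI[of _ "\<lambda>_. 0"])
  fix x y assume "x \<in> irr M j"
  then obtain f where f: "x = (\<Sum>v\<in>UNIV. vscale (Var v) (f v))" "\<And>v. f v \<in> M (j - 1)"
    by (auto simp: irr_def)
  {
    assume "y \<in> irr M j"
    then obtain g where g: "y = (\<Sum>v\<in>UNIV. vscale (Var v) (g v))" "\<And>v. g v \<in> M (j - 1)"
      by (auto simp: irr_def)
    show "x + y \<in> irr M j"
      unfolding irr_def using f g kvec.subspace_add[OF assms]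
      by (auto simp: scale_right_distrib sum.distrib intro!: exI[of _ "\<lambda>v. f v + g v"])
  }
  fix c
  have "kscale c x = (\<Sum>v\<in>UNIV. vscale (Var v) (kscale c (f v)))"
    by (simp add: f(1) kscale_def scale_sum_right mult.commute)
  then show "kscale c x \<in> irr M j"
    unfolding irr_def using f(2) kvec.subspace_scale[OF assms] by (auto intro!: exI[of _ "\<lambda>v. kscale c (f v)"])
qed

lemma irr_subset:
  assumes "graded_family vscale M"
  shows "irr M j \<subseteq> M j"
proof
  fix x assume "x \<in> irr M j"
  then obtain f where f: "x = (\<Sum>v\<in>UNIV. vscale (Var v) (f v))" "\<And>v. f v \<in> M (j - 1)"
    by (auto simp: irr_def)
  have "vscale (Var v) (f v) \<in> M j" for v
    using graded_family_Var[OF assms f(2)[of v]] by simp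
  then show "x \<in> M j"
    unfolding f(1) by (intro graded_family_sum[OF assms])
qed

lemma zcomp_family:
  assumes "module.subspace vscale Z"
  shows "graded_family vscale (zcomp B dg Z)"
proof -
  interpret module vscale
    by (rule module_scale_vec)
  show ?thesis
    using fhoms_family[of B dg] subspace_0[OF assms] subspace_add[OF assms] subspace_diff[OF assms]
      subspace_scale[OF assms]
    unfolding graded_family_def zcomp_def by auto
qed

lemma vcompo_decomposition:
  assumes "finite B" "v \<in> free_on B"
  obtains J where "v = (\<Sum>j\<in>J. vcompo B dg j v)"
proof
  define J where "J = (\<Union>b\<in>B. (\<lambda>m. int (mon_degree m) + dg b) ` keys (lookup v b))"
  have finJ: "finite J"
    unfolding J_def using assms(1) by auto
  show "v = (\<Sum>j\<in>J. vcompo B dg j v)"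
  proof (intro poly_mapping_eqI)
    fix b m
    show "lookup (lookup v b) m = lookup (lookup (\<Sum>j\<in>J. vcompo B dg j v) b) m"
    proof (cases "b \<in> B")
      case True
      have "lookup (lookup (\<Sum>j\<in>J. vcompo B dg j v) b) m
          = (\<Sum>j\<in>J. if j = int (mon_degree m) + dg b then lookup (lookup v b) m else 0)"
        unfolding lookup_sum using True
        by (intro sum.cong) (auto simp: lookup_vcompo[OF assms(1)] lookup_compo)
      also have "\<dots> = lookup (lookup v b) m"
      proof (cases "lookup (lookup v b) m = 0")
        case False
        then have "int (mon_degree m) + dg b \<in> J"
          using True by (force simp: J_def in_keys_iff)
        then show ?thesis
          using finJ by simp
      qed (simp only: if_cancel sum.neutral_const)
      finally show ?thesis by simp
    next
      case False
      then show ?thesis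
        using assms(2) by (simp add: lookup_sum lookup_vcompo[OF assms(1)] free_on_iff)
    qed
  qed
qed

text \<open>The invariant of the construction. Nonnegative degrees give the induction on degree a
  start, and the vanishing of \<open>tor\<close> bounds the degrees of generators. It is required
  for all \<open>p\<close>, since the next syzygy module inherits its vanishing at \<open>p\<close>
  from \<open>Suc p\<close> here.\<close>

definition good_syzygy :: "nat set \<Rightarrow> (nat \<Rightarrow> int) \<Rightarrow> (nat \<Rightarrow>\<^sub>0 ('v::finite, 'k::field) mpoly) set \<Rightarrow> bool" where
  "good_syzygy B dg Z \<longleftrightarrow> finite B \<and> (\<forall>b\<in>B. 0 \<le> dg b) \<and> Z \<subseteq> free_on B \<and> module.subspace vscale Z \<and>
     (\<forall>v\<in>Z. \<forall>j. vcompo B dg j v \<in> Z) \<and> (\<forall>v\<in>Z. free_const_zero v) \<and>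
     (\<forall>p j. j > int (card (UNIV :: 'v set)) \<longrightarrow> \<not> tor vscale (zcomp B dg Z) (\<lambda>_. {0}) p j)"

definition next_syzygy :: "nat set \<Rightarrow> (nat \<Rightarrow> int) \<Rightarrow> (nat \<Rightarrow>\<^sub>0 ('v::finite, 'k::field) mpoly) set \<Rightarrow>
    ((nat \<Rightarrow>\<^sub>0 ('v, 'k) mpoly) \<Rightarrow> (nat \<Rightarrow>\<^sub>0 ('v, 'k) mpoly)) \<Rightarrow> nat set \<Rightarrow> (nat \<Rightarrow> int) \<Rightarrow> bool" where
  "next_syzygy B dg Z d B' dg' \<longleftrightarrow> module_hom vscale vscale d \<and> d ` free_on B' = Z \<and>
     (\<forall>b\<in>B'. \<forall>c\<in>B. homogeneous (dg' b - dg c) (lookup (d (basis_vec b)) c))"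

text \<open>In each degree, elements of \<open>Z\<close> are chosen that form a basis modulo the
  irrelevant ideal times \<open>Z\<close>. Spanning gives generation by graded Nakayama, and
  independence gives minimality of the new cover.\<close>

lemma next_syzygy_exists:
  fixes Z :: "(nat \<Rightarrow>\<^sub>0 ('v::finite, 'k::field) mpoly) set"
  assumes good: "good_syzygy B dg Z"
  obtains d B' dg' where "next_syzygy B dg Z d B' dg'" "good_syzygy B' dg' {v \<in> free_on B'. d v = 0}"
proof -
  interpret module "vscale :: ('v, 'k) mpoly \<Rightarrow> _"
    by (rule module_scale_vec)
  let ?N = "int (card (UNIV :: 'v set))"
  let ?M = "zcomp B dg Z"
  from good have fin: "finite B" and nonneg: "\<And>b. b \<in> B \<Longrightarrow> 0 \<le> dg b" and sub: "Z \<subseteq> free_on B"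
    and Z: "subspace Z" and Z_compo: "\<And>v j. v \<in> Z \<Longrightarrow> vcompo B dg j v \<in> Z"
    and tor0: "\<And>p j. j > ?N \<Longrightarrow> \<not> tor vscale ?M (\<lambda>_. {0}) p j"
    unfolding good_syzygy_def by blast+
  note M_family = zcomp_family[OF Z, of B dg]
  have ksp: "kvec.subspace (?M j)" for j
    by (rule zcomp_kspace[OF Z])
  have "\<exists>C. finite C \<and> C \<subseteq> ?M j \<and> (\<forall>v\<in>?M j. \<exists>a. v - (\<Sum>c\<in>C. kscale (a c) c) \<in> irr ?M j) \<and>
      (\<forall>a. (\<Sum>c\<in>C. kscale (a c) c) \<in> irr ?M j \<longrightarrow> (\<forall>c\<in>C. a c = 0))" for j
  proof -
    obtain G :: "(nat \<Rightarrow>\<^sub>0 ('v, 'k) mpoly) set" where "finite G" "fhoms B dg j \<subseteq> kvec.span G"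
      using fhoms_finite_span[OF fin] .
    then have "finite G" "?M j \<subseteq> kvec.span G"
      by (auto simp: zcomp_def)
    then show ?thesis
      by (rule kvec.finite_complement[OF _ _ irr_kspace[where M = ?M, OF ksp] ksp irr_subset[OF M_family]])
  qed
  then have "\<exists>C. \<forall>j. finite (C j) \<and> C j \<subseteq> ?M j \<and>
      (\<forall>v\<in>?M j. \<exists>a. v - (\<Sum>c\<in>C j. kscale (a c) c) \<in> irr ?M j) \<and>
      (\<forall>a. (\<Sum>c\<in>C j. kscale (a c) c) \<in> irr ?M j \<longrightarrow> (\<forall>c\<in>C j. a c = 0))"
    by (intro choice allI)
  then obtain C where C: "\<And>j. finite (C j) \<and> C j \<subseteq> ?M j \<and>
      (\<forall>v\<in>?M j. \<exists>a. v - (\<Sum>c\<in>C j. kscale (a c) c) \<in> irr ?M j) \<and>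
      (\<forall>a. (\<Sum>c\<in>C j. kscale (a c) c) \<in> irr ?M j \<longrightarrow> (\<forall>c\<in>C j. a c = 0))"
    by auto
  have finC: "\<And>j. finite (C j)" and C_M: "\<And>j. C j \<subseteq> ?M j"
    and C_span: "\<And>j v. v \<in> ?M j \<Longrightarrow> \<exists>a. v - (\<Sum>c\<in>C j. kscale (a c) c) \<in> irr ?M j"
    and C_indep: "\<And>j a c. (\<Sum>c\<in>C j. kscale (a c) c) \<in> irr ?M j \<Longrightarrow> c \<in> C j \<Longrightarrow> a c = 0"
    using C by blast+
  \<comment> \<open>Other degrees contribute no generators: below 0 the components are zero because
    \<open>dg\<close> is nonnegative, and above \<open>?N\<close> they equal \<open>irr ?M j\<close>
    because \<open>tor\<close> vanishes there.\<close>
  define P where "P = (SIGMA j:{0..?N}. C j)"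
  have finP: "finite P"
    unfolding P_def using finC by auto
  define B' where "B' = {0..<card P}"
  obtain \<pi> where \<pi>: "bij_betw \<pi> B' P"
    unfolding B'_def using ex_bij_betw_nat_finite[OF finP] by blast
  define gen where "gen b = snd (\<pi> b)" for b
  define dg' where "dg' b = fst (\<pi> b)" for b
  define d where "d v = (\<Sum>b\<in>B'. vscale (lookup v b) (gen b))" for v :: "nat \<Rightarrow>\<^sub>0 ('v, 'k) mpoly"
  have finB': "finite B'"
    by (simp add: B'_def)
  have gen: "gen b \<in> C (dg' b)" "0 \<le> dg' b" "dg' b \<le> ?N" if "b \<in> B'" for b
    using bij_betwE[OF \<pi>] that by (auto simp: P_def gen_def dg'_def)
  have gen_M: "gen b \<in> ?M (dg' b)" if "b \<in> B'" for b
    using gen(1)[OF that] C_M by blast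
  have hom_d: "module_hom vscale vscale d"
    by (auto simp: module_hom_iff module_axioms d_def lookup_add scale_left_distrib sum.distrib scale_sum_right)
  interpret d: module_hom vscale vscale d
    by (rule hom_d)
  have d_basis: "d (basis_vec b) = gen b" if "b \<in> B'" for b
    using finB' that
    by (simp add: d_def lookup_single when_def if_distrib[of "\<lambda>c. vscale c _"] cong: if_cong)
  have entries: "homogeneous (dg' b - dg c) (lookup (d (basis_vec b)) c)" if "b \<in> B'" "c \<in> B" for b c
    using gen_M[OF that(1)] by (simp add: d_basis[OF that(1)] zcomp_def fhoms_def)
  let ?W = "d ` free_on B'"
  have free_subspace: "subspace (free_on B')"
    by (rule subspaceI) (auto intro: free_on_0 free_on_add free_on_scale)
  have W: "subspace ?W"
    by (rule d.subspace_image[OF free_subspace])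
  have kW: "kscale a x \<in> ?W" if "x \<in> ?W" for a x
    unfolding kscale_def by (rule subspace_scale[OF W that])
  have gen_W: "gen b \<in> ?W" if "b \<in> B'" for b
    using d_basis[OF that] that by (auto simp: free_on_def intro!: image_eqI[of _ _ "basis_vec b"])
  \<comment> \<open>Graded Nakayama: modulo the generators, an element of degree \<open>j\<close>
    lies in \<open>irr ?M j\<close>, whose coefficients have degree \<open>j - 1\<close>. The bound
    \<open>n\<close> turns this into an induction starting in negative degrees, where
    \<open>?M j\<close> is zero.\<close>
  have M_W: "?M j \<subseteq> ?W" if "j < int n" for j n
    using that
  proof (induction n arbitrary: j)
    case 0
    have "v = 0" if "v \<in> ?M j" for v
    proof (rule poly_mapping_eqI)
      fix b
      show "lookup v b = lookup 0 b"
      proof (cases "b \<in> B")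
        case True
        have "homogeneous (j - dg b) (lookup v b)"
          using that by (simp add: zcomp_def fhoms_def)
        moreover have "j - dg b < 0"
          using nonneg[OF True] 0 by simp
        ultimately have "keys (lookup v b) = {}"
          unfolding homogeneous_def by (metis all_not_in_conv of_nat_less_0_iff)
        then show ?thesis by simp
      qed (use that in \<open>auto simp: zcomp_def fhoms_def free_on_iff\<close>)
    qed
    then show ?case
      using subspace_0[OF W] by blast
  next
    case (Suc n)
    show ?case
    proof
      fix z assume z: "z \<in> ?M j"
      have irr_W: "x \<in> ?W" if x: "x \<in> irr ?M j" for x
      proof -
        obtain f where f: "x = (\<Sum>v\<in>UNIV. vscale (Var v) (f v))" "\<And>v. f v \<in> ?M (j - 1)"
          using x by (auto simp: irr_def)
        have "f v \<in> ?W" for v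
          using Suc.IH[of "j - 1"] Suc.prems f(2) by auto
        then show ?thesis
          unfolding f(1) by (intro subspace_sum[OF W] subspace_scale[OF W])
      qed
      show "z \<in> ?W"
      proof (cases "0 \<le> j \<and> j \<le> ?N")
        case True
        obtain a where a: "z - (\<Sum>c\<in>C j. kscale (a c) c) \<in> irr ?M j"
          using C_span[OF z] by blast
        have "c \<in> ?W" if c: "c \<in> C j" for c
        proof -
          have "(j, c) \<in> P"
            using c True by (simp add: P_def)
          then obtain b where "b \<in> B'" "\<pi> b = (j, c)"
            using bij_betw_imp_surj_on[OF \<pi>] by (metis imageE)
          then show ?thesis
            using gen_W[of b] by (simp add: gen_def)
        qed
        then have "(\<Sum>c\<in>C j. kscale (a c) c) \<in> ?W"
          by (intro subspace_sum[OF W] kW)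
        from subspace_add[OF W irr_W[OF a] this] show ?thesis
          by simp
      next
        case False
        show ?thesis
        proof (cases "j > ?N")
          case True
          then show ?thesis
            using irr_W irr_if_not_tor[where M = ?M, OF tor0 z] by blast
        next
          case False
          then have "j < int n"
            using \<open>\<not> (0 \<le> j \<and> j \<le> ?N)\<close> by simp
          then show ?thesis
            using Suc.IH z by blast
        qed
      qed
    qed
  qed
  have W_eq: "?W = Z"
  proof
    show "?W \<subseteq> Z"
      using gen_M by (auto simp: d_def zcomp_def intro!: subspace_sum[OF Z] subspace_scale[OF Z])
    show "Z \<subseteq> ?W"
    proof
      fix v assume v: "v \<in> Z"
      obtain J where J: "v = (\<Sum>j\<in>J. vcompo B dg j v)"
        using vcompo_decomposition[OF fin, of v dg] v sub by blast
      have "vcompo B dg j v \<in> ?M j" for j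
        using vcompo_fhoms[OF fin] Z_compo[OF v] by (simp add: zcomp_def)
      moreover have "?M j \<subseteq> ?W" for j
        by (rule M_W[of j "nat (j + 1)"]) linarith
      ultimately have "vcompo B dg j v \<in> ?W" for j
        by blast
      then show "v \<in> ?W"
        by (subst J) (intro subspace_sum[OF W])
    qed
  qed
  have link: "next_syzygy B dg Z d B' dg'"
    unfolding next_syzygy_def using hom_d W_eq entries by blast
  have vc: "vcompo B dg j (d v) = d (vcompo B' dg' j v)" if "v \<in> free_on B'" for v j
    using sub W_eq by (intro vcompo_hom[OF hom_d finB' fin that _ entries]) auto
  have d_M: "d v \<in> ?M j" if "v \<in> fhoms B' dg' j" for v j
    using vc[OF fhoms_subset[OF that], of j] vcompo_id[OF finB' that] vcompo_fhoms[OF fin, of dg j "d v"]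
      fhoms_subset[OF that] W_eq by (auto simp: zcomp_def)
  have minimal: "free_const_zero v" if v: "v \<in> free_on B'" "d v = 0" for v
    unfolding free_const_zero_def
  proof
    fix b
    show "lookup (lookup v b) 0 = 0"
    proof (cases "b \<in> B'")
      case False
      then show ?thesis
        using v(1) by (simp add: free_on_iff)
    next
      case True
      define j where "j = dg' b"
      define w where "w = vcompo B' dg' j v"
      define L where "L = {b \<in> B'. dg' b = j}"
      \<comment> \<open>\<open>w0\<close> is the constant part of \<open>w\<close>; in degree
        \<open>j\<close> constants sit only at basis vectors of degree \<open>j\<close>. The rest
        \<open>w - w0\<close> is a combination of the variables, so \<open>d w = 0\<close> puts
        \<open>d w0\<close> into \<open>irr ?M j\<close>. As \<open>d w0\<close> is a linear
        combination of \<open>C j\<close>, its coefficients vanish.\<close>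
      define w0 where "w0 = (\<Sum>b\<in>L. single b (single 0 (lookup (lookup v b) 0)) :: nat \<Rightarrow>\<^sub>0 ('v, 'k) mpoly)"
      have finL: "finite L"
        by (simp add: L_def finB')
      have lookup_w0: "lookup w0 b = (if b \<in> L then single 0 (lookup (lookup v b) 0) else 0)" for b
        unfolding w0_def using finL by (rule lookup_sum_single)
      have "d w = vcompo B dg j 0"
        using vc[OF v(1), of j] v(2) by (simp add: w_def)
      then have dw: "d w = 0"
        by (simp add: vcompo_def)
      have w: "w \<in> fhoms B' dg' j"
        unfolding w_def by (rule vcompo_fhoms[OF finB'])
      have w0: "w0 \<in> fhoms B' dg' j"
        by (auto simp: fhoms_def free_on_iff lookup_w0 L_def intro!: homogeneous_single simp: mon_degree_def)
      let ?c = "\<lambda>S :: 'v set. if S = {} then w - w0 else 0"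
      have "?c \<in> kchains (fhoms B' dg') 0 j"
        using graded_family_diff[OF fhoms_family w w0] by (intro kchainsI) (auto simp: card_eq_0_iff)
      moreover have "bd vscale ?c T = 0" for T
        by (auto simp: bd_def intro!: sum.neutral)
      moreover have "free_const_zero (?c {})"
        unfolding free_const_zero_def
        by (auto simp: lookup_minus lookup_w0 w_def L_def lookup_vcompo[OF finB'] lookup_compo mon_degree_def)
      ultimately have "\<exists>h\<in>kchains (fhoms B' dg') (Suc 0) j. \<forall>T. bd vscale h T = ?c T"
        by (intro free_acyclic[OF finB'])
      then obtain h where h: "h \<in> kchains (fhoms B' dg') (Suc 0) j" "\<And>T. bd vscale h T = ?c T"
        by (elim bexE) (rule that, assumption, rule spec)
      have "w - w0 = (\<Sum>v\<in>UNIV. vscale (Var v) (h {v}))"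
        using h(2)[of "{}"] by (simp add: bd_def)
      then have "d w - d w0 = (\<Sum>v\<in>UNIV. vscale (Var v) (d (h {v})))"
        by (simp add: d.sum d.scale flip: d.diff)
      moreover have "d (h {v}) \<in> ?M (j - 1)" for v
        using kchainsD[OF h(1), of "{v}"] by (intro d_M) simp
      ultimately have "d w - d w0 \<in> irr ?M j"
        unfolding irr_def by (intro CollectI exI[of _ "\<lambda>v. d (h {v})"]) simp
      then have irr: "d w0 \<in> irr ?M j"
        using kvec.subspace_neg[OF irr_kspace[where M = ?M, OF ksp]] dw by fastforce
      \<comment> \<open>The independence statement indexes coefficients by the elements of
        \<open>C j\<close>, so the constants of \<open>v\<close> are carried over from indices to
        generators.\<close>
      define a where "a c = lookup (lookup v (inv_into B' \<pi> (j, c))) 0" for c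
      have a_gen: "a (gen b) = lookup (lookup v b) 0" if "b \<in> L" for b
      proof -
        have "\<pi> b = (j, gen b)" "b \<in> B'"
          using that by (auto simp: L_def dg'_def gen_def)
        then show ?thesis
          using bij_betw_inv_into_left[OF \<pi>, of b] by (simp add: a_def)
      qed
      have bij: "bij_betw gen L (C j)"
      proof (rule bij_betw_imageI)
        show "inj_on gen L"
        proof (rule inj_onI)
          fix b1 b2 assume "b1 \<in> L" "b2 \<in> L" "gen b1 = gen b2"
          then have "\<pi> b1 = \<pi> b2" "b1 \<in> B'" "b2 \<in> B'"
            by (auto simp: L_def dg'_def gen_def prod_eq_iff)
          then show "b1 = b2"
            using bij_betw_imp_inj_on[OF \<pi>] by (simp add: inj_on_eq_iff)
        qed
        show "gen ` L = C j"
        proof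
          show "gen ` L \<subseteq> C j"
            using gen(1) by (auto simp: L_def)
          show "C j \<subseteq> gen ` L"
          proof
            fix c assume "c \<in> C j"
            then have "(j, c) \<in> P"
              using gen(2,3)[OF True] by (simp add: P_def j_def)
            then obtain b where "b \<in> B'" "\<pi> b = (j, c)"
              using bij_betw_imp_surj_on[OF \<pi>] by (metis imageE)
            then show "c \<in> gen ` L"
              by (auto simp: L_def dg'_def gen_def intro!: image_eqI[of _ _ b])
          qed
        qed
      qed
      have "d w0 = (\<Sum>b\<in>L. kscale (lookup (lookup v b) 0) (gen b))"
        unfolding d_def kscale_def lookup_w0 using finB'
        by (intro sum.mono_neutral_cong_right) (auto simp: L_def)
      also have "\<dots> = (\<Sum>b\<in>L. kscale (a (gen b)) (gen b))"
        by (intro sum.cong) (auto simp: a_gen)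
      also have "\<dots> = (\<Sum>c\<in>C j. kscale (a c) c)"
        by (rule sum.reindex_bij_betw[OF bij])
      finally have "a (gen b) = 0"
        using C_indep[of a j "gen b"] irr gen(1)[OF True] by (simp add: j_def)
      then show ?thesis
        using a_gen[of b] True by (simp add: L_def j_def)
    qed
  qed
  let ?Z' = "{v \<in> free_on B'. d v = 0}"
  interpret cover: minimal_cover vscale d B' dg' ?M "\<lambda>_. {0}" "zcomp B' dg' ?Z'"
    by (rule differential_cover[OF hom_d finB' fin sub Z W_eq entries minimal])
  have "good_syzygy B' dg' ?Z'"
    unfolding good_syzygy_def
  proof (intro conjI ballI allI impI)
    show "subspace ?Z'"
      using subspace_inter[OF free_subspace d.subspace_kernel] by (simp add: Int_def)
    show "vcompo B' dg' j v \<in> ?Z'" if "v \<in> ?Z'" for v j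
      using that vc[of v j] fhoms_subset[OF vcompo_fhoms[OF finB']] by (simp add: vcompo_def[of B])
    show "\<not> tor vscale (zcomp B' dg' ?Z') (\<lambda>_. {0}) p j" if "j > ?N" for p j
      using cover.tor_Suc[of p j] tor0[OF that] by simp
  qed (use finB' gen(2) minimal in auto)
  then show thesis
    using that link by blast
qed

text \<open>The ring itself, on one basis vector of degree 0, covers the quotient; iterating
  \<open>next_syzygy_exists\<close> from its kernel yields all further steps.\<close>

lemma minimal_resolution_exists:
  fixes E :: "'v::finite set set"
  assumes "simple_graph E"
  shows "\<exists>B deg e d. minimal_graded_free_resolution (edge_ideal E :: ('v, 'k::field) mpoly set) B deg e d"
proof -
  let ?I = "edge_ideal E :: ('v, 'k) mpoly set"
  define e where "e v = lookup v 0" for v :: "nat \<Rightarrow>\<^sub>0 ('v, 'k) mpoly"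
  define Z0 where "Z0 = {v \<in> free_on {0}. e v \<in> ?I}"
  have hom_e: "module_hom vscale (*) e"
    by (auto simp: module_hom_iff module_scale_vec module_mult e_def lookup_add)
  have homog: "homogeneous ((\<lambda>_. 0) b) (e (basis_vec b))" for b :: nat
    by (auto simp: e_def lookup_single when_def homogeneous_def mon_degree_def)
  have surj: "\<exists>v\<in>free_on {0}. f - e v \<in> ?I" for f
    by (rule bexI[of _ "single 0 f"]) (auto simp: e_def edge_ideal_0 free_on_iff lookup_single)
  have const: "free_const_zero v" if v: "v \<in> free_on {0}" "e v \<in> ?I" for v
    unfolding free_const_zero_def
  proof
    fix b
    \<comment> \<open>Edges are nonempty, so no element of the ideal has a constant term; this makes
      the initial cover minimal.\<close>
    have "indep E (keys (0 :: 'v \<Rightarrow>\<^sub>0 nat))"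
      using assms by (auto simp: indep_def simple_graph_def)
    then have "lookup (e v) 0 = 0"
      using v(2) unfolding edge_ideal_eq[OF assms] by (auto simp: not_in_keys_iff_lookup_eq_zero[symmetric])
    then show "lookup (lookup v b) 0 = 0"
      using v(1) by (cases "b = 0") (auto simp: e_def free_on_iff)
  qed
  interpret cover: minimal_cover "(*)" e "{0}" "\<lambda>_. 0" homs "edge_comp E" "zcomp {0} (\<lambda>_. 0) Z0"
    unfolding Z0_def by (rule augmentation_cover[OF assms hom_e _ homog surj const]) auto
  have Z0: "good_syzygy {0} (\<lambda>_. 0) Z0"
    unfolding good_syzygy_def
  proof (intro conjI ballI allI impI)
    show "module.subspace vscale Z0"
      unfolding Z0_def using hom_e
      by (intro module.subspaceI[OF module_scale_vec])
        (auto simp: module_hom_iff free_on_0 free_on_add free_on_scale edge_ideal_0 edge_ideal_add edge_ideal_mult e_def lookup_add)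
    show "vcompo {0} (\<lambda>_. 0) j v \<in> Z0" if "v \<in> Z0" for v j
      using that compo_augmentation[OF hom_e _ _ homog, of "{0}" v j] edge_ideal_compo[OF assms, of "e v" j]
        fhoms_subset[OF vcompo_fhoms[of "{0}"]] by (simp add: Z0_def)
    show "\<not> tor vscale (zcomp {0} (\<lambda>_. 0) Z0) (\<lambda>_. {0}) p j" if "j > int (card (UNIV :: 'v set))" for p j
    proof
      assume "tor vscale (zcomp {0} (\<lambda>_. 0) Z0) (\<lambda>_. {0}) p j"
      then have "tor (*) (homs :: int \<Rightarrow> ('v, 'k) mpoly set) (edge_comp E) (Suc p) j"
        by (simp add: cover.tor_Suc)
      \<comment> \<open>Only squarefree multidegrees carry homology, so the degree is the size of a
        vertex set.\<close>
      then obtain W :: "'v set" where "int (card W) = j"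
        unfolding tor_edge_ideal[OF assms] by blast
      then show False
        using that card_mono[of UNIV W] by simp
    qed
  qed (auto simp: Z0_def const)
  define good where "good x = (case x of (B, dg, Z) \<Rightarrow> good_syzygy B dg Z)"
    for x :: "nat set \<times> (nat \<Rightarrow> int) \<times> (nat \<Rightarrow>\<^sub>0 ('v, 'k) mpoly) set"
  define succ where "succ x y \<longleftrightarrow> (\<exists>d. next_syzygy (fst x) (fst (snd x)) (snd (snd x)) d (fst y) (fst (snd y)) \<and>
      snd (snd y) = {v \<in> free_on (fst y). d v = 0})"
    for x y :: "nat set \<times> (nat \<Rightarrow> int) \<times> (nat \<Rightarrow>\<^sub>0 ('v, 'k) mpoly) set"
  \<comment> \<open>Dependent choice on triples of basis, degrees and syzygy module. The clause for
    \<open>n = 0\<close> pins the start, which dependent choice alone would leave open.\<close>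
  have "\<exists>X. \<forall>n. (good (X n) \<and> (n = 0 \<longrightarrow> X n = ({0}, (\<lambda>_. 0), Z0))) \<and> succ (X n) (X (Suc n))"
  proof (rule dependent_nat_choice)
    show "\<exists>x. good x \<and> (0 = (0::nat) \<longrightarrow> x = ({0}, (\<lambda>_. 0), Z0))"
      using Z0 by (auto simp: good_def)
    fix x and n :: nat assume "good x \<and> (n = 0 \<longrightarrow> x = ({0}, (\<lambda>_. 0), Z0))"
    then have "good_syzygy (fst x) (fst (snd x)) (snd (snd x))"
      by (simp add: good_def split: prod.splits)
    then obtain d B' dg' where "next_syzygy (fst x) (fst (snd x)) (snd (snd x)) d B' dg'"
      "good_syzygy B' dg' {v \<in> free_on B'. d v = 0}"
      by (rule next_syzygy_exists)
    then show "\<exists>y. (good y \<and> (Suc n = 0 \<longrightarrow> y = ({0}, (\<lambda>_. 0), Z0))) \<and> succ x y"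
      by (intro exI[of _ "(B', dg', {v \<in> free_on B'. d v = 0})"]) (auto simp: good_def succ_def)
  qed
  then obtain X where good: "\<And>n. good (X n)" and X0: "X 0 = ({0}, (\<lambda>_. 0), Z0)"
    and succ: "\<And>n. succ (X n) (X (Suc n))"
    by blast
  define B where "B n = fst (X n)" for n
  define deg where "deg n = fst (snd (X n))" for n
  define Z where "Z n = snd (snd (X n))" for n
  have good: "good_syzygy (B n) (deg n) (Z n)" for n
    using good[of n] by (simp add: good_def B_def deg_def Z_def split: prod.splits)
  have "\<forall>n. \<exists>d. next_syzygy (B n) (deg n) (Z n) d (B (Suc n)) (deg (Suc n)) \<and>
      Z (Suc n) = {v \<in> free_on (B (Suc n)). d v = 0}"
    using succ unfolding succ_def B_def deg_def Z_def by blast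
  from choice[OF this] obtain d
    where d: "\<And>n. next_syzygy (B n) (deg n) (Z n) (d n) (B (Suc n)) (deg (Suc n))"
    and Z_Suc: "\<And>n. Z (Suc n) = {v \<in> free_on (B (Suc n)). d n v = 0}"
    by auto
  have B0: "B 0 = {0}" and deg0: "deg 0 = (\<lambda>_. 0)" and Z_0: "Z 0 = {v \<in> free_on (B 0). e v \<in> ?I}"
    by (simp_all add: B_def deg_def Z_def X0 Z0_def)
  have image: "d n ` free_on (B (Suc n)) = Z n" for n
    using d[of n] by (simp add: next_syzygy_def)
  have "exact_resolution ?I (\<lambda>i. free_on (B i)) e d"
    unfolding exact_resolution_def
  proof (intro conjI allI)
    show "module.subspace vscale (free_on (B i))" for i
      by (intro module.subspaceI[OF module_scale_vec] free_on_0 free_on_add free_on_scale)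
    show "module_hom vscale vscale (d i)" for i
      using d[of i] by (simp add: next_syzygy_def)
    show "\<exists>v\<in>free_on (B 0). f - e v \<in> ?I" for f
      unfolding B0 by (rule surj)
    show "d 0 ` free_on (B 1) = {v \<in> free_on (B 0). e v \<in> ?I}"
      using image[of 0] Z_0 by simp
    show "d (Suc i) ` free_on (B (Suc (Suc i))) = {v \<in> free_on (B (Suc i)). d i v = 0}" for i
      using image[of "Suc i"] Z_Suc by simp
  qed (rule hom_e)
  moreover have "lookup (d i v) c \<in> irrelevant_ideal" if "v \<in> free_on (B (Suc i))" for i v c
  proof -
    have "d i v \<in> Z i"
      using image[of i] that by blast
    then show ?thesis
      using good[of i] by (auto simp: good_syzygy_def free_const_zero_def irrelevant_ideal_eq)
  qed
  moreover have "finite (B i)" for i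
    using good[of i] by (simp add: good_syzygy_def)
  moreover have "homogeneous (deg 0 b) (e (basis_vec b))" for b
    using homog[of b] by (simp add: deg0)
  moreover have "homogeneous (deg (Suc i) b - deg i c) (lookup (d i (basis_vec b)) c)"
    if "b \<in> B (Suc i)" "c \<in> B i" for i b c
    using d[of i] that by (simp add: next_syzygy_def)
  ultimately have "minimal_graded_free_resolution ?I B deg e d"
    unfolding minimal_graded_free_resolution_def by simp
  then show ?thesis
    by blast
qed


section \<open>Subadditivity\<close>

text \<open>Existence ensures that the choice by \<open>SOME\<close> is a minimal resolution. Which
  one is irrelevant to vanishing, as \<open>resolution_tor\<close> holds for all of them.\<close>

lemma betti_edge_ideal:
  fixes E :: "'v::finite set set"
  assumes "simple_graph E"
  shows "betti_quotient (edge_ideal E :: ('v, 'k::field) mpoly set) i j \<noteq> 0 \<longleftrightarrow>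
    (\<exists>W. int (card W) = j \<and> i \<le> card W \<and> coh TYPE('k) E W (card W - i))"
proof -
  let ?I = "edge_ideal E :: ('v, 'k) mpoly set"
  let ?P = "\<lambda>(B, deg). \<exists>e d. minimal_graded_free_resolution ?I B deg e d"
  obtain B deg where some: "(SOME x. ?P x) = (B, deg)"
    by fastforce
  have "?P (SOME x. ?P x)"
    using minimal_resolution_exists[OF assms] by (intro someI_ex[of ?P]) auto
  then obtain e d where res: "minimal_graded_free_resolution ?I B deg e d"
    unfolding some by auto
  have "betti_quotient ?I i j = card {b \<in> B i. deg i b = j}"
    unfolding betti_quotient_def some by simp
  moreover have "finite (B i)"
    using res by (simp add: minimal_graded_free_resolution_def)
  ultimately have "betti_quotient ?I i j \<noteq> 0 \<longleftrightarrow> (\<exists>b\<in>B i. deg i b = j)"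
    by auto
  then show ?thesis
    using resolution_tor[OF assms res] tor_edge_ideal[OF assms] by metis
qed

text \<open>By Hochster's formula, the squarefree multidegrees in which the Koszul homology of
  degree \<open>i\<close> is nonzero.\<close>

definition betti_sets :: "'k::field itself \<Rightarrow> 'v::finite set set \<Rightarrow> nat \<Rightarrow> 'v set set" where
  "betti_sets K E i = {W. i \<le> card W \<and> coh K E W (card W - i)}"

lemma max_shift_eq:
  assumes "simple_graph E"
  shows "max_shift TYPE('k::field) E i = (SUP W\<in>betti_sets TYPE('k) E i. ereal (real (card W)))"
proof -
  have "{ereal (real_of_int j) | j. betti_quotient (edge_ideal E :: ('a, 'k) mpoly set) i j \<noteq> 0}
      = (\<lambda>W. ereal (real (card W))) ` betti_sets TYPE('k) E i"
    unfolding betti_edge_ideal[OF assms] betti_sets_def by (auto simp: image_def) (metis of_int_of_nat_eq)+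
  then show ?thesis
    by (simp add: max_shift_def)
qed

text \<open>Deleting one vertex keeps the cohomological index, as \<open>card W\<close> and the
  homological degree both drop by one. In the third case of Mayer--Vietoris two vertices go and the
  index drops by one, so again the homological degree drops by one. Hence the loss of at most
  2.\<close>

lemma betti_sets_Suc:
  assumes "simple_graph E" "W \<in> betti_sets K E (Suc i)"
  shows "\<exists>W'\<in>betti_sets K E i. card W \<le> card W' + 2"
proof -
  from assms(2) have card: "Suc i \<le> card W" and coh: "coh K E W (card W - Suc i)"
    by (simp_all add: betti_sets_def)
  have "W \<noteq> {}"
    using card by auto
  \<comment> \<open>A nonempty simplex has no cohomology, so \<open>W\<close> contains an edge at
    which to split.\<close>
  then have "\<not> indep E W"
    using not_coh_simplex coh by blast
  then obtain a where a: "a \<in> E" "a \<subseteq> W"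
    by (auto simp: indep_def)
  then obtain x y where xy: "{x, y} \<in> E" "x \<noteq> y" "x \<in> W" "y \<in> W"
    using assms(1) unfolding simple_graph_def by (metis card_2_iff insert_subset)
  from coh_Mayer_Vietoris[OF xy(1) coh] show ?thesis
  proof (elim disjE exE conjE)
    assume "coh K E (W - {x}) (card W - Suc i)"
    then show ?thesis
      using card xy by (intro bexI[of _ "W - {x}"]) (auto simp: betti_sets_def)
  next
    assume "coh K E (W - {y}) (card W - Suc i)"
    then show ?thesis
      using card xy by (intro bexI[of _ "W - {y}"]) (auto simp: betti_sets_def)
  next
    fix r assume r: "card W - Suc i = Suc r" "coh K E (W - {x, y}) r"
    have "card (W - {x, y}) = card W - 2"
      using xy by (subst card_Diff_subset) auto
    moreover from this r(1) have "r = card (W - {x, y}) - i" "i \<le> card (W - {x, y})"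
      by simp_all
    ultimately show ?thesis
      using r(2) by (intro bexI[of _ "W - {x, y}"]) (auto simp: betti_sets_def)
  qed
qed

lemma betti_sets_add:
  assumes "simple_graph E" "W \<in> betti_sets K E (a + b)"
  shows "\<exists>W'\<in>betti_sets K E a. card W \<le> card W' + 2 * b"
  using assms(2)
proof (induction b arbitrary: W)
  case 0
  then show ?case by auto
next
  case (Suc b)
  then obtain W1 where W1: "W1 \<in> betti_sets K E (a + b)" "card W \<le> card W1 + 2"
    using betti_sets_Suc[OF assms(1), of W K "a + b"] by auto
  obtain W2 where "W2 \<in> betti_sets K E a" "card W1 \<le> card W2 + 2 * b"
    using Suc.IH[OF W1(1)] by blast
  then show ?case
    using W1(2) by (intro bexI[of _ W2]) auto
qed

text \<open>An edge inside the smaller vertex set belongs to \<open>M\<close> and meets a member of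
  \<open>M'\<close>; as \<open>M\<close> is a matching, the two coincide. This gives induced
  matchings of every size up to the maximum.\<close>

lemma induced_matching_subset:
  assumes "simple_graph E" "induced_matching E M" "M' \<subseteq> M"
  shows "induced_matching E M'"
proof -
  have M: "M \<subseteq> E" "pairwise disjnt M" and ind: "\<And>a. a \<in> E \<Longrightarrow> a \<subseteq> \<Union>M \<Longrightarrow> a \<in> M"
    using assms(2) unfolding induced_matching_def matching_def by blast+
  have "a \<in> M'" if a: "a \<in> E" "a \<subseteq> \<Union>M'" for a
  proof -
    have "a \<noteq> {}"
      using assms(1) a(1) by (auto simp: simple_graph_def)
    then obtain x b where x: "x \<in> a" "b \<in> M'" "x \<in> b"
      using a(2) by blast
    have "a \<in> M"
      using ind[OF a(1)] a(2) assms(3) by blast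
    then have "a = b"
      using M(2) x assms(3) unfolding pairwise_def disjnt_def by blast
    then show ?thesis
      using x(2) by simp
  qed
  then show ?thesis
    using M assms(3) unfolding induced_matching_def matching_def
    by (auto intro: pairwise_subset)
qed

lemma betti_sets_induced_matching:
  fixes E :: "'v::finite set set"
  assumes "simple_graph E" "b \<le> induced_matching_number E"
  shows "\<exists>W\<in>betti_sets K E b. card W = 2 * b"
proof -
  have "induced_matching E {}"
    using assms(1) by (auto simp: induced_matching_def matching_def simple_graph_def)
  then have "{card M | M. induced_matching E M} \<noteq> {}"
    by blast
  moreover have "{card M | M. induced_matching E M} = card ` {M. induced_matching E M}"
    by blast
  ultimately have "induced_matching_number E \<in> {card M | M. induced_matching E M}"
    unfolding induced_matching_number_def by (intro Max_in) auto
  then obtain M where M: "induced_matching E M" "b \<le> card M"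
    using assms(2) by auto
  obtain M' where M': "M' \<subseteq> M" "card M' = b"
    using obtain_subset_with_card_n[OF M(2)] by blast
  have "coh K E (\<Union>M') b \<and> card (\<Union>M') = 2 * b"
    using coh_induced_matching[OF finite assms(1) induced_matching_subset[OF assms(1) M(1) M'(1)]] M'(2) by simp
  then show ?thesis
    \<comment> \<open>The cohomological index required by \<open>betti_sets\<close> is
      \<open>2 * b - b = b\<close>, the one in which the sphere has cohomology.\<close>
    by (intro bexI[of _ "\<Union>M'"]) (auto simp: betti_sets_def)
qed

theorem proposition2p7:
  fixes E :: "'v::finite set set" and a b :: nat
  assumes "simple_graph E"
    and "a \<ge> 1"
    and "b \<le> induced_matching_number E"
    and "enat (a + b) \<le> proj_dim_quotient (edge_ideal E :: ('v, 'k::field) mpoly set)"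
  shows "max_shift TYPE('k) E (a + b) \<le> max_shift TYPE('k) E a + max_shift TYPE('k) E b"
  unfolding max_shift_eq[OF assms(1)]
\<comment> \<open>Bounding one \<open>W\<close> at a time avoids asking whether the suprema are
  attained; if no \<open>W\<close> exists, the left side is minus infinity.\<close>
proof (rule SUP_least)
  fix W assume "W \<in> betti_sets TYPE('k) E (a + b)"
  then obtain W1 where W1: "W1 \<in> betti_sets TYPE('k) E a" "card W \<le> card W1 + 2 * b"
    using betti_sets_add[OF assms(1)] by blast
  obtain W2 where W2: "W2 \<in> betti_sets TYPE('k) E b" "card W2 = 2 * b"
    using betti_sets_induced_matching[OF assms(1,3)] by blast
  have "ereal (real (card W)) \<le> ereal (real (card W1)) + ereal (real (card W2))"
    using W1(2) W2(2) by simp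
  also have "\<dots> \<le> (SUP W\<in>betti_sets TYPE('k) E a. ereal (real (card W))) +
      (SUP W\<in>betti_sets TYPE('k) E b. ereal (real (card W)))"
    by (intro add_mono SUP_upper W1(1) W2(1))
  finally show "ereal (real (card W)) \<le> (SUP W\<in>betti_sets TYPE('k) E a. ereal (real (card W))) +
      (SUP W\<in>betti_sets TYPE('k) E b. ereal (real (card W)))" .
qed

end
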